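(* Let $k\ge 1$ and $n\ge k$ be integers, let $N=\lceil \log_2((n+1)/k)\rceil$, $m=n+1-k$, $d=k(2^N-1)$, and $$n_U=\left\lfloor \frac{k2^N-n-1}{2}\right\rfloor,\qquad n_D=k2^N-n-1-n_U .$$ Let $\mathbf H=[H_{ij}]_{i,j=1}^m$ be a real symmetric positive definite band matrix with $H_{ij}=0$ whenever $|i-j|>k$. Define the $d\times d$ matrix $\widetilde{\mathbf H}$ by $$\widetilde H_{ij}=\begin{cases}1, & i=j \text{ and } (i\le n_U \text{ or } i>d-n_D),\\ H_{i'j'}, & i=n_U+i',\ j=n_U+j',\ i',j'\in\{1,\dots,m\},\\ 0, & \text{otherwise.}\end{cases}$$ Let $\widetilde{\mathbf P}$ be the $d\times d$ output matrix of the dyadic orthogonalization algorithm (described in the context) applied to $\widetilde{\mathbf H}$, and let $\mathbf P=[\widetilde P_{ij}]_{i,j=n_U+1}^{d-n_D}$ be its central $m\times m$ submatrix. Then $$\mathbf I_m=\mathbf P^\top \mathbf H\,\mathbf P .$$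
   Context: Symmetrized Gram-Schmidt orthonormalization $\mathcal G$. For linearly independent vectors $x_1,\dots,x_q$ in a real inner product space, $\mathcal G(x_1,\dots,x_q)=(y_1,\dots,y_q)$ is defined as follows. For $r=1,\dots,\lfloor q/2\rfloor$ let $V_{r-1}$ be the span of $\{x_j,x_{q-j+1}: j<r\}$ (with $V_0=\{0\}$), let $u_r$ be the normalization of $x_r$ minus its orthogonal projection on $V_{r-1}$, let $v_r$ be the normalization of $x_{q-r+1}$ minus its orthogonal projection on $V_{r-1}$, and put $$y_r=\frac1{\sqrt2}\left(\frac{u_r+v_r}{\|u_r+v_r\|}+\frac{u_r-v_r}{\|u_r-v_r\|}\right),\qquad y_{q-r+1}=\frac1{\sqrt2}\left(\frac{u_r+v_r}{\|u_r+v_r\|}-\frac{u_r-v_r}{\|u_r-v_r\|}\right).$$ If $q$ is odd, $y_{(q+1)/2}$ is the normalization of $x_{(q+1)/2}$ minus its orthogonal projection on the span of all the other $x_j$'s. Dyadic orthogonalization algorithm. Input: a symmetric positive definite $d\times d$ matrix $\widetilde{\mathbf H}$, $d=k(2^N-1)$, with $\widetilde H_{ij}=0$ for $|i-j|>k$. Work in $\mathbb R^d$ with inner product $\langle u,v\rangle=u^\top\widetilde{\mathbf H}v$ (so that the canonical basis has Gram matrix $\widetilde{\mathbf H}$). Initialize $p_i=e_i$ (canonical basis vector), $i=1,\dots,d$, and group the vectors into $k$-tuplets $T_j=(p_{(j-1)k+1},\dots,p_{jk})$, $j=1,\dots,2^N-1$. Each $j$ is uniquely written as $j=2^{l}(2i-1)$,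 with $l\in\{0,\dots,N-1\}$ called the level of $T_j$. For $l=0,1,\dots,N-1$ successively: (a) for every tuplet $T_j$ of level $l$, replace the current vectors of $T_j$ by $\mathcal G(T_j)$ (keeping positions); (b) for every tuplet $T_j$ of level larger than $l$, replace each of its vectors $p$ by $p$ minus its orthogonal projection on the span of $T_{j-2^l}$ minus its orthogonal projection on the span of $T_{j+2^l}$ (these two tuplets have level $l$ and have just been orthonormalized in (a)). Output: the $d\times d$ matrix $\widetilde{\mathbf P}$ whose $i$th column is the final vector $p_i$. *)

theory Defs
  imports Complex_Main "Jordan_Normal_Form.VS_Connect"
begin

definition ip :: "real mat \<Rightarrow> real vec \<Rightarrow> real vec \<Rightarrow> real" where
  "ip A u v = u \<bullet> (A *\<^sub>v v)"

definition ip_norm :: "real mat \<Rightarrow> real vec \<Rightarrow> real" where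
  "ip_norm A v = sqrt (ip A v v)"

definition normalize_vec :: "real mat \<Rightarrow> real vec \<Rightarrow> real vec" where
  "normalize_vec A v = (1 / ip_norm A v) \<cdot>\<^sub>v v"

definition sym_pos_def :: "real mat \<Rightarrow> bool" where
  "sym_pos_def A \<longleftrightarrow> transpose_mat A = A \<and>
     (\<forall>v \<in> carrier_vec (dim_row A). v \<noteq> 0\<^sub>v (dim_row A) \<longrightarrow> v \<bullet> (A *\<^sub>v v) > 0)"

definition vec_span :: "nat \<Rightarrow> real vec set \<Rightarrow> real vec set" where
  "vec_span d S = LinearCombinations.module.span class_ring (module_vec TYPE(real) d) S"

definition orth_proj :: "real mat \<Rightarrow> real vec set \<Rightarrow> real vec \<Rightarrow> real vec" where
  "orth_proj A W x = (THE w. w \<in> W \<and> (\<forall>v \<in> W. ip A (x - w) v = 0))"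

definition resid :: "real mat \<Rightarrow> real vec set \<Rightarrow> real vec \<Rightarrow> real vec" where
  "resid A S x = x - orth_proj A (vec_span (dim_row A) S) x"

text \<open>Symmetrized Gram-Schmidt orthonormalization with respect to \<^term>\<open>ip A\<close>.
  Tuples are 0-indexed lists \<open>xs\<close> of length \<open>q\<close>, so the vectors paired in round \<open>r < q div 2\<close>
  are \<open>xs ! r\<close> and \<open>xs ! (q - 1 - r)\<close>; the spans are those of the original vectors.\<close>

definition sgs_u :: "real mat \<Rightarrow> real vec list \<Rightarrow> nat \<Rightarrow> real vec" where
  "sgs_u A xs r = normalize_vec A
     (resid A {xs ! i | i. \<exists>j<r. i = j \<or> i = length xs - 1 - j} (xs ! r))"

definition sgs_v :: "real mat \<Rightarrow> real vec list \<Rightarrow> nat \<Rightarrow> real vec" where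
  "sgs_v A xs r = normalize_vec A
     (resid A {xs ! i | i. \<exists>j<r. i = j \<or> i = length xs - 1 - j} (xs ! (length xs - 1 - r)))"

definition sgs_mid :: "real mat \<Rightarrow> real vec list \<Rightarrow> real vec" where
  "sgs_mid A xs = normalize_vec A
     (resid A {xs ! j | j. j < length xs \<and> j \<noteq> length xs div 2} (xs ! (length xs div 2)))"

definition sym_gram_schmidt :: "real mat \<Rightarrow> real vec list \<Rightarrow> real vec list" where
  "sym_gram_schmidt A xs =
     (let q = length xs;
          plus = (\<lambda>r. normalize_vec A (sgs_u A xs r + sgs_v A xs r));
          minus = (\<lambda>r. normalize_vec A (sgs_u A xs r - sgs_v A xs r))
      in map (\<lambda>i.
           if i < q div 2 then (1 / sqrt 2) \<cdot>\<^sub>v (plus i + minus i)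
           else if q - 1 - i < q div 2 then (1 / sqrt 2) \<cdot>\<^sub>v (plus (q - 1 - i) - minus (q - 1 - i))
           else sgs_mid A xs) [0..<q])"

text \<open>The state of the dyadic algorithm maps \<open>j\<close> to the tuplet \<open>T\<^sub>j\<close>. Only the values at
  \<open>1 \<le> j < 2 ^ N\<close> are relevant: a tuplet \<open>j\<close> in this range of level larger than \<open>l\<close> refers only to
  \<open>j - 2 ^ l\<close> and \<open>j + 2 ^ l\<close>, which lie in this range again.\<close>

definition level :: "nat \<Rightarrow> nat" where
  "level j = (THE l. \<exists>i\<ge>1. j = 2 ^ l * (2 * i - 1))"

definition dyadic_init :: "nat \<Rightarrow> nat \<Rightarrow> nat \<Rightarrow> real vec list" where
  "dyadic_init d k j = map (\<lambda>i. unit_vec d ((j - 1) * k + i)) [0..<k]"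

definition dyadic_orth_step ::
  "real mat \<Rightarrow> nat \<Rightarrow> (nat \<Rightarrow> real vec list) \<Rightarrow> nat \<Rightarrow> real vec list" where
  "dyadic_orth_step A l T = (\<lambda>j. if level j = l then sym_gram_schmidt A (T j) else T j)"

definition dyadic_proj_step ::
  "real mat \<Rightarrow> nat \<Rightarrow> (nat \<Rightarrow> real vec list) \<Rightarrow> nat \<Rightarrow> real vec list" where
  "dyadic_proj_step A l T = (\<lambda>j. if level j > l then
       map (\<lambda>p. p - orth_proj A (vec_span (dim_row A) (set (T (j - 2 ^ l)))) p
                  - orth_proj A (vec_span (dim_row A) (set (T (j + 2 ^ l)))) p) (T j)
     else T j)"

definition dyadic_state :: "nat \<Rightarrow> nat \<Rightarrow> real mat \<Rightarrow> nat \<Rightarrow> real vec list" where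
  "dyadic_state k N A =
     fold (\<lambda>l T. dyadic_proj_step A l (dyadic_orth_step A l T)) [0..<N] (dyadic_init (dim_row A) k)"

definition dyadic_orthogonalization :: "nat \<Rightarrow> nat \<Rightarrow> real mat \<Rightarrow> real mat" where
  "dyadic_orthogonalization k N A =
     mat_of_cols (dim_row A) (concat (map (dyadic_state k N A) [1..<2 ^ N]))"

end

theory Submission
  imports Defs
begin

text \<open>The proof has two independent parts. Throughout, \<open>A\<close> is the padded matrix, and orthogonality refers to
  \<open>\<langle>u, v\<rangle> = u\<^sup>T A v\<close>.

  The first part is that the algorithm orthonormalizes: its \<open>d\<close> output vectors are orthonormal for every
  symmetric positive definite band matrix \<open>A\<close> of bandwidth \<open>k\<close> and size \<open>d = k * (2 ^ N - 1)\<close>.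
  Initially two tuplets are orthogonal unless they are adjacent, because of the band structure. Tuplets of level
  \<open>0\<close> sit at odd positions, hence are never adjacent, and orthonormalizing each of them by itself makes all of them
  orthonormal together. Removing from the even tuplets the components along their two neighbours makes these orthogonal
  to all tuplets of level \<open>0\<close>. It also creates new inner products, but only between even tuplets that share
  a neighbour, that is, between those at distance \<open>2\<close>. Thus the even tuplets form the same situation at half the size,
  and the argument repeats (\<open>invariant_step\<close>). Within a tuplet the symmetrized Gram-Schmidt procedure needs linear
  independence. It holds because the vectors of a tuplet that is still to be treated are their initial unit vectors
  plus combinations of unit vectors that belong to tuplets already treated.

  The second part is that the padding does not interfere. A priori a tuplet that straddles the boundary of the
  central block could mix padded and central coordinates. It does not, because of the symmetrization: changing the sign
  of one input vector only changes the sign of the output vector in the same position (\<open>signed_sym_gram_schmidt\<close>).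
  A padded coordinate \<open>c\<close> is orthogonal to all others, so the reflection in \<open>c\<close> is an isometry; it changes the
  sign of the input vector at \<open>c\<close> and fixes the other ones. Since projections commute with isometries that preserve the subspace,
  the outputs at other positions are fixed by the reflection, so their component at \<open>c\<close> vanishes
  (\<open>column_zero_at_decoupled\<close>).

  Together, the central columns of the output are orthonormal and vanish outside the central
  block, where \<open>A\<close> agrees with \<open>H\<close>; this is the claim.\<close>

section \<open>Subspaces and spans\<close>

definition lin_subspace :: "nat \<Rightarrow> real vec set \<Rightarrow> bool" where
  "lin_subspace d W \<longleftrightarrow> W \<subseteq> carrier_vec d \<and> 0\<^sub>v d \<in> W \<and>
     (\<forall>u\<in>W. \<forall>v\<in>W. u + v \<in> W) \<and> (\<forall>c. \<forall>v\<in>W. c \<cdot>\<^sub>v v \<in> W)"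

lemma lin_subspaceD:
  assumes "lin_subspace d W"
  shows "v \<in> W \<Longrightarrow> v \<in> carrier_vec d" and "0\<^sub>v d \<in> W"
    and "u \<in> W \<Longrightarrow> v \<in> W \<Longrightarrow> u + v \<in> W"
    and "v \<in> W \<Longrightarrow> c \<cdot>\<^sub>v v \<in> W"
    and "u \<in> W \<Longrightarrow> v \<in> W \<Longrightarrow> u - v \<in> W"
proof -
  show "v \<in> W \<Longrightarrow> v \<in> carrier_vec d" "0\<^sub>v d \<in> W"
    and a: "u \<in> W \<Longrightarrow> v \<in> W \<Longrightarrow> u + v \<in> W" and s: "v \<in> W \<Longrightarrow> c \<cdot>\<^sub>v v \<in> W" for u v c
    using assms by (auto simp: lin_subspace_def)
  assume u: "u \<in> W" and v: "v \<in> W"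
  have "u - v = u + (-1) \<cdot>\<^sub>v v"
    using u v assms by (intro eq_vecI) (auto simp: lin_subspace_def)
  then show "u - v \<in> W" using a[OF u s[OF v]] by simp
qed

lemma vec_diff_add_cancel:
  fixes u v :: "real vec"
  assumes "u \<in> carrier_vec d" "v \<in> carrier_vec d"
  shows "u - v + v = u"
  using assms by (intro eq_vecI) auto

lemma lin_subspace_vec_span:
  assumes "S \<subseteq> carrier_vec d"
  shows "lin_subspace d (vec_span d S)"
proof -
  interpret vec_space "TYPE(real)" d .
  show ?thesis
    unfolding lin_subspace_def vec_span_def
    using span_is_subset2[OF assms] span_zero span_add1[OF assms] smult_in_span[OF assms] by auto
qed

lemma vec_span_superset:
  assumes "S \<subseteq> carrier_vec d"
  shows "S \<subseteq> vec_span d S"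
proof -
  interpret vec_space "TYPE(real)" d .
  show ?thesis unfolding vec_span_def using in_own_span[OF assms] .
qed

text \<open>Together with \<open>lin_subspace_vec_span\<close> and \<open>vec_span_superset\<close> this is the universal property
  of the span. All later statements about spans go through it: to show that a property passes from
  generators to a span, it suffices that the vectors with this property form a subspace.\<close>

lemma vec_span_least:
  assumes W: "lin_subspace d W" and SW: "S \<subseteq> W"
  shows "vec_span d S \<subseteq> W"
proof -
  interpret vec_space "TYPE(real)" d .
  have fin: "finite T \<Longrightarrow> T \<subseteq> W \<Longrightarrow> lincomb a T \<in> W" for a T
  proof (induction T rule: finite_induct)
    case empty
    then show ?case using W by (simp add: lin_subspace_def lincomb_def)
  next
    case (insert x T)
    have c: "T \<subseteq> carrier_vec d" "x \<in> carrier_vec d"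
      using insert.prems W by (auto simp: lin_subspace_def)
    have "lincomb a (insert x T) = a x \<cdot>\<^sub>v x + lincomb a T"
      by (rule lincomb_insert2)
        (use insert.hyps c in auto)
    then show ?case
      using insert W by (auto intro!: lin_subspaceD[OF W])
  qed
  show ?thesis
    unfolding vec_span_def span_def using fin SW by auto
qed

lemma vec_span_mono:
  assumes "T \<subseteq> carrier_vec d" "S \<subseteq> vec_span d T"
  shows "vec_span d S \<subseteq> vec_span d T"
  using vec_span_least[OF lin_subspace_vec_span[OF assms(1)] assms(2)] .

lemma vec_span_closed:
  assumes "S \<subseteq> carrier_vec d"
  shows "v \<in> vec_span d S \<Longrightarrow> v \<in> carrier_vec d"
    and "s \<in> S \<Longrightarrow> s \<in> vec_span d S"
    and "0\<^sub>v d \<in> vec_span d S"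
    and "u \<in> vec_span d S \<Longrightarrow> v \<in> vec_span d S \<Longrightarrow> u + v \<in> vec_span d S"
    and "u \<in> vec_span d S \<Longrightarrow> v \<in> vec_span d S \<Longrightarrow> u - v \<in> vec_span d S"
    and "v \<in> vec_span d S \<Longrightarrow> c \<cdot>\<^sub>v v \<in> vec_span d S"
  using lin_subspaceD[OF lin_subspace_vec_span[OF assms]] vec_span_superset[OF assms] by auto

section \<open>Orthogonality and projection for a Gram matrix\<close>

locale gram_space =
  fixes A :: "real mat" and d :: nat
  assumes A_carrier: "A \<in> carrier_mat d d" and A_spd: "sym_pos_def A"
begin

lemma dim_A [simp]: "dim_row A = d" "dim_col A = d"
  using A_carrier by auto

lemma ip_sum:
  assumes "u \<in> carrier_vec d" "v \<in> carrier_vec d"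
  shows "ip A u v = (\<Sum>i<d. \<Sum>j<d. u $ i * (A $$ (i, j) * v $ j))"
  using assms A_carrier
  by (auto simp: ip_def scalar_prod_def sum_distrib_left atLeast0LessThan intro!: sum.cong)

lemma ip_add_left:
  assumes "u \<in> carrier_vec d" "v \<in> carrier_vec d" "w \<in> carrier_vec d"
  shows "ip A (u + v) w = ip A u w + ip A v w"
  unfolding ip_def using assms A_carrier by (intro add_scalar_prod_distrib[of _ d]) auto

lemma ip_smult_left:
  assumes "u \<in> carrier_vec d" "v \<in> carrier_vec d"
  shows "ip A (c \<cdot>\<^sub>v u) v = c * ip A u v"
  unfolding ip_def using assms A_carrier by (intro smult_scalar_prod_distrib[of _ d]) auto

lemma ip_sym:
  assumes "u \<in> carrier_vec d" "v \<in> carrier_vec d"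
  shows "ip A u v = ip A v u"
proof -
  have sym: "A $$ (i, j) = A $$ (j, i)" if "i < d" "j < d" for i j
    using A_spd A_carrier that unfolding sym_pos_def_def by (metis carrier_matD index_transpose_mat(1))
  show ?thesis
    unfolding ip_sum[OF assms] ip_sum[OF assms(2,1)]
    by (subst sum.swap) (auto intro!: sum.cong simp: sym)
qed

lemma ip_add_right:
  assumes "u \<in> carrier_vec d" "v \<in> carrier_vec d" "w \<in> carrier_vec d"
  shows "ip A w (u + v) = ip A w u + ip A w v"
  using assms ip_add_left[OF assms] by (simp add: ip_sym[of w])

lemma ip_smult_right:
  assumes "u \<in> carrier_vec d" "v \<in> carrier_vec d"
  shows "ip A v (c \<cdot>\<^sub>v u) = c * ip A v u"
  using assms ip_smult_left[OF assms] by (simp add: ip_sym[of v])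

lemma minus_as_add:
  assumes "u \<in> carrier_vec d" "v \<in> carrier_vec d"
  shows "u - v = u + (-1) \<cdot>\<^sub>v (v :: real vec)"
  using assms by (intro eq_vecI) auto

lemma ip_minus_left:
  assumes "u \<in> carrier_vec d" "v \<in> carrier_vec d" "w \<in> carrier_vec d"
  shows "ip A (u - v) w = ip A u w - ip A v w"
  using assms by (simp add: minus_as_add ip_add_left ip_smult_left)

lemma ip_minus_right:
  assumes "u \<in> carrier_vec d" "v \<in> carrier_vec d" "w \<in> carrier_vec d"
  shows "ip A w (u - v) = ip A w u - ip A w v"
  using assms by (simp add: minus_as_add ip_add_right ip_smult_right)

lemma ip_zero [simp]:
  assumes "v \<in> carrier_vec d"
  shows "ip A (0\<^sub>v d) v = 0" "ip A v (0\<^sub>v d) = 0"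
  using assms ip_smult_left[of v v 0] ip_smult_right[of v v 0] by (auto simp: ip_sum)

lemmas ip_simps = ip_add_left ip_add_right ip_minus_left ip_minus_right ip_smult_left ip_smult_right

lemma ip_pos:
  assumes "v \<in> carrier_vec d" "v \<noteq> 0\<^sub>v d"
  shows "ip A v v > 0"
  using A_spd assms unfolding sym_pos_def_def ip_def by auto

lemma ip_self_eq_0:
  assumes "v \<in> carrier_vec d" "ip A v v = 0"
  shows "v = 0\<^sub>v d"
  using ip_pos assms by force

lemma lin_subspace_orth_complement:
  assumes "x \<in> carrier_vec d"
  shows "lin_subspace d {v \<in> carrier_vec d. ip A x v = 0}"
  using assms by (auto simp: lin_subspace_def ip_simps)

definition orth :: "real vec set \<Rightarrow> real vec set \<Rightarrow> bool" where
  "orth S T \<longleftrightarrow> (\<forall>u\<in>S. \<forall>v\<in>T. ip A u v = 0)"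

lemma orth_sym:
  assumes "S \<subseteq> carrier_vec d" "T \<subseteq> carrier_vec d" "orth S T"
  shows "orth T S"
  using assms ip_sym unfolding orth_def by (metis subsetD)

lemma orth_mono: "orth S T \<Longrightarrow> S' \<subseteq> S \<Longrightarrow> T' \<subseteq> T \<Longrightarrow> orth S' T'"
  by (auto simp: orth_def)

lemma orth_span_right:
  assumes "S \<subseteq> carrier_vec d" "T \<subseteq> carrier_vec d" "orth S T"
  shows "orth S (vec_span d T)"
  unfolding orth_def
proof (intro ballI)
  fix u v assume u: "u \<in> S" and v: "v \<in> vec_span d T"
  have "vec_span d T \<subseteq> {v \<in> carrier_vec d. ip A u v = 0}"
    using u assms by (intro vec_span_least lin_subspace_orth_complement) (auto simp: orth_def)
  then show "ip A u v = 0" using v by auto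
qed

lemma orth_span:
  assumes S: "S \<subseteq> carrier_vec d" and T: "T \<subseteq> carrier_vec d" and "orth S T"
  shows "orth (vec_span d S) (vec_span d T)"
proof -
  have sub: "vec_span d S \<subseteq> carrier_vec d" "vec_span d T \<subseteq> carrier_vec d"
    using vec_span_closed(1)[OF S] vec_span_closed(1)[OF T] by blast+
  have "orth (vec_span d T) S"
    by (rule orth_sym[OF S sub(2) orth_span_right[OF assms]])
  then have "orth (vec_span d T) (vec_span d S)"
    by (rule orth_span_right[OF sub(2) S])
  then show ?thesis
    by (rule orth_sym[OF sub(2,1)])
qed

text \<open>The projection onto the span of finitely many vectors is built up one generator at a time: a new
  generator \<open>s\<close> is first replaced by its residual \<open>t\<close> modulo the old ones, and the component of \<open>x\<close>
  along \<open>t\<close> is then added to the old projection.\<close>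

lemma projection_exists:
  assumes "finite S" "S \<subseteq> carrier_vec d" "x \<in> carrier_vec d"
  shows "\<exists>w\<in>vec_span d S. \<forall>v\<in>vec_span d S. ip A (x - w) v = 0"
  using assms
proof (induction S arbitrary: x rule: finite_induct)
  case empty
  have "lin_subspace d {0\<^sub>v d}" by (auto simp: lin_subspace_def)
  then have "vec_span d {} \<subseteq> {0\<^sub>v d}" by (rule vec_span_least) simp
  moreover have "0\<^sub>v d \<in> vec_span d {}"
    using lin_subspaceD(2)[OF lin_subspace_vec_span[of "{}" d]] by simp
  ultimately show ?case using empty by (auto intro!: bexI[of _ "0\<^sub>v d"])
next
  case (insert s S)
  let ?W = "vec_span d S" and ?W' = "vec_span d (insert s S)"
  have S: "S \<subseteq> carrier_vec d" and s: "s \<in> carrier_vec d" using insert.prems by auto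
  have sub: "?W \<subseteq> ?W'"
    using insert.prems vec_span_superset[of "insert s S" d]
    by (intro vec_span_mono) auto
  note W' = vec_span_closed[OF insert.prems(1)]
  note W = vec_span_closed[OF S]
  obtain p where p: "p \<in> ?W" "\<And>v. v \<in> ?W \<Longrightarrow> ip A (s - p) v = 0"
    using insert.IH[OF S s] by auto
  obtain w where w: "w \<in> ?W" "\<And>v. v \<in> ?W \<Longrightarrow> ip A (x - w) v = 0"
    using insert.IH[OF S insert.prems(2)] by auto
  define t where "t = s - p"
  define z where "z = w + (ip A x t / ip A t t) \<cdot>\<^sub>v t"
  have [simp]: "p \<in> carrier_vec d" "w \<in> carrier_vec d" "x \<in> carrier_vec d" "s \<in> carrier_vec d"
    and tc[simp]: "t \<in> carrier_vec d"
    using p w W(1) insert.prems s by (auto simp: t_def)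
  have t: "t \<in> ?W'" unfolding t_def using p sub W' by auto
  have z: "z \<in> ?W'" unfolding z_def using w sub t W' by auto
  have zc [simp]: "z \<in> carrier_vec d" unfolding z_def by auto
  have tw: "ip A t v = 0" if "v \<in> ?W" for v using p that by (simp add: t_def)
  \<comment> \<open>If \<open>t = 0\<close>, the coefficient is a quotient by zero; its value does not matter then.\<close>
  have zt: "ip A (x - z) t = 0"
  proof (cases "t = 0\<^sub>v d")
    case True
    then show ?thesis by simp
  next
    case False
    then have "ip A t t \<noteq> 0" using ip_pos by force
    then show ?thesis using tw[OF w(1)] ip_sym[of w t] by (simp add: z_def ip_simps)
  qed
  have zW: "ip A (x - z) v = 0" if v: "v \<in> ?W" for v
  proof -
    have "v \<in> carrier_vec d" using v W(1) by auto
    then show ?thesis using w(2)[OF v] tw[OF v] by (simp add: z_def ip_simps)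
  qed
  have "ip A (x - z) s = ip A (x - z) (t + p)"
  proof -
    have "s = t + p" unfolding t_def by (rule vec_diff_add_cancel[symmetric, of _ d]) simp_all
    then show ?thesis by simp
  qed
  also have "\<dots> = 0" using zt zW[OF p(1)] by (simp add: ip_add_right)
  finally have zs: "ip A (x - z) s = 0" .
  have "vec_span d (insert s S) \<subseteq> {v \<in> carrier_vec d. ip A (x - z) v = 0}"
    using zs zW W insert.prems by (intro vec_span_least lin_subspace_orth_complement) auto
  then show ?case using z by (intro bexI[of _ z]) auto
qed

lemma projection_unique:
  assumes W: "lin_subspace d W" and x: "x \<in> carrier_vec d"
    and "w \<in> W" "\<forall>v\<in>W. ip A (x - w) v = 0" "w' \<in> W" "\<forall>v\<in>W. ip A (x - w') v = 0"
  shows "w = w'"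
proof -
  have c: "w \<in> carrier_vec d" "w' \<in> carrier_vec d" and m: "w - w' \<in> W"
    using assms lin_subspaceD[OF W] by auto
  have "ip A (w - w') (w - w') = ip A (x - w') (w - w') - ip A (x - w) (w - w')"
    using c x by (simp add: ip_simps)
  also have "\<dots> = 0" using assms(4,6) m by simp
  finally have z: "w - w' = 0\<^sub>v d" using ip_self_eq_0 c by simp
  show ?thesis
  proof (rule eq_vecI)
    fix i assume "i < dim_vec w'"
    then show "w $ i = w' $ i"
      using arg_cong[OF z, of "\<lambda>v. v $ i"] c by auto
  qed (use c in auto)
qed

lemma orth_proj_equality:
  assumes W: "lin_subspace d W" and x: "x \<in> carrier_vec d"
    and "w \<in> W" "\<forall>v\<in>W. ip A (x - w) v = 0"
  shows "orth_proj A W x = w"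
  unfolding orth_proj_def using assms projection_unique[OF W x] by (intro the_equality) auto

text \<open>With existence and uniqueness the definite description \<open>orth_proj\<close> denotes the projection, so
  its two defining properties may be used from here on.\<close>

lemma orth_proj:
  assumes "finite S" "S \<subseteq> carrier_vec d" "x \<in> carrier_vec d"
  shows "orth_proj A (vec_span d S) x \<in> vec_span d S"
    and "v \<in> vec_span d S \<Longrightarrow> ip A (x - orth_proj A (vec_span d S) x) v = 0"
proof -
  obtain w where w: "w \<in> vec_span d S" "\<forall>v\<in>vec_span d S. ip A (x - w) v = 0"
    using projection_exists[OF assms] by auto
  have "orth_proj A (vec_span d S) x = w"
    using orth_proj_equality[OF lin_subspace_vec_span[OF assms(2)] assms(3) w] .
  then show "orth_proj A (vec_span d S) x \<in> vec_span d S"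
    and "v \<in> vec_span d S \<Longrightarrow> ip A (x - orth_proj A (vec_span d S) x) v = 0"
    using w by auto
qed

lemma normalize_vec_carrier [simp]: "v \<in> carrier_vec d \<Longrightarrow> normalize_vec A v \<in> carrier_vec d"
  by (simp add: normalize_vec_def)

lemma ip_normalize_self:
  assumes "v \<in> carrier_vec d" "v \<noteq> 0\<^sub>v d"
  shows "ip A (normalize_vec A v) (normalize_vec A v) = 1"
proof -
  have "ip A v v > 0" using ip_pos assms by auto
  then have "ip A v v \<noteq> 0" "ip_norm A v > 0" "ip_norm A v * ip_norm A v = ip A v v"
    by (simp_all add: ip_norm_def)
  then show ?thesis
    using assms(1) by (simp add: normalize_vec_def ip_smult_left ip_smult_right)
qed

end

section \<open>Symmetrized Gram-Schmidt orthonormalization\<close>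

text \<open>The vectors at positions \<open>j\<close> and \<open>q - 1 - j\<close> are treated in the same round \<open>min j (q - 1 - j)\<close>,
  and for odd \<open>q\<close> the middle vector has a last round of its own. This set holds the inputs of all
  rounds before \<open>r\<close>; it is the one onto whose span round \<open>r\<close> projects, also in the middle.\<close>

definition outer :: "real vec list \<Rightarrow> nat \<Rightarrow> real vec set" where
  "outer xs r = {xs ! j | j. j < length xs \<and> min j (length xs - 1 - j) < r}"

definition others :: "real vec list \<Rightarrow> nat \<Rightarrow> real vec set" where
  "others xs i = {xs ! j | j. j < length xs \<and> j \<noteq> i}"

text \<open>Linear independence of the list, in the form in which it is used: a list with a repeated entry
  violates it, since the positions and not the vectors are compared.\<close>

definition indep :: "nat \<Rightarrow> real vec list \<Rightarrow> bool" where
  "indep d xs \<longleftrightarrow> (\<forall>i<length xs. xs ! i \<notin> vec_span d (others xs i))"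

lemma outer_subset: "outer xs r \<subseteq> set xs"
  by (auto simp: outer_def)

lemma others_subset: "others xs i \<subseteq> set xs"
  by (auto simp: others_def)

lemma finite_outer: "finite (outer xs r)"
  using outer_subset finite_set finite_subset by metis

lemma outer_mono: "r \<le> s \<Longrightarrow> outer xs r \<subseteq> outer xs s"
  unfolding outer_def by (auto intro: less_le_trans)

lemma paired_eq_outer:
  assumes "r < length xs div 2"
  shows "{xs ! i | i. \<exists>j<r. i = j \<or> i = length xs - 1 - j} = outer xs r"
proof -
  have "(\<exists>j<r. i = j \<or> i = length xs - 1 - j) \<longleftrightarrow>
      i < length xs \<and> min i (length xs - 1 - i) < r" (is "?L \<longleftrightarrow> ?R") for i
  proof
    show "?L \<Longrightarrow> ?R" using assms by auto
    assume R: ?R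
    show ?L
    proof (cases "i < r")
      case False
      then have "length xs - 1 - i < r" "i = length xs - 1 - (length xs - 1 - i)" using R by auto
      then show ?thesis by blast
    qed auto
  qed
  then show ?thesis unfolding outer_def by simp
qed

lemma others_mid_eq_outer:
  assumes "odd (length xs)"
  shows "others xs (length xs div 2) = outer xs (length xs div 2)"
proof -
  have "j < length xs \<and> j \<noteq> length xs div 2 \<longleftrightarrow>
      j < length xs \<and> min j (length xs - 1 - j) < length xs div 2" for j
    using assms by (auto elim!: oddE simp: min_def)
  then show ?thesis unfolding outer_def others_def by simp
qed

lemma length_sym_gram_schmidt [simp]: "length (sym_gram_schmidt A xs) = length xs"
  by (simp add: sym_gram_schmidt_def Let_def)

lemma sym_gram_schmidt_nth:
  fixes A xs r
  defines "u \<equiv> normalize_vec A (resid A (outer xs r) (xs ! r))"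
    and "v \<equiv> normalize_vec A (resid A (outer xs r) (xs ! (length xs - 1 - r)))"
  assumes "r < length xs div 2"
  shows "sym_gram_schmidt A xs ! r =
      (1 / sqrt 2) \<cdot>\<^sub>v (normalize_vec A (u + v) + normalize_vec A (u - v))"
    and "sym_gram_schmidt A xs ! (length xs - 1 - r) =
      (1 / sqrt 2) \<cdot>\<^sub>v (normalize_vec A (u + v) - normalize_vec A (u - v))"
proof -
  have uv: "sgs_u A xs r = u" "sgs_v A xs r = v"
    unfolding sgs_u_def sgs_v_def u_def v_def paired_eq_outer[OF assms(3)] by auto
  have "r < length xs" "length xs - 1 - r < length xs" "\<not> length xs - 1 - r < length xs div 2"
    "length xs - 1 - (length xs - 1 - r) = r" using assms(3) by auto
  then show "sym_gram_schmidt A xs ! r =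
      (1 / sqrt 2) \<cdot>\<^sub>v (normalize_vec A (u + v) + normalize_vec A (u - v))"
    and "sym_gram_schmidt A xs ! (length xs - 1 - r) =
      (1 / sqrt 2) \<cdot>\<^sub>v (normalize_vec A (u + v) - normalize_vec A (u - v))"
    using assms(3) uv by (simp_all add: sym_gram_schmidt_def Let_def)
qed

lemma sym_gram_schmidt_nth_mid:
  assumes "odd (length xs)"
  shows "sym_gram_schmidt A xs ! (length xs div 2) =
    normalize_vec A (resid A (outer xs (length xs div 2)) (xs ! (length xs div 2)))"
proof -
  have "length xs div 2 < length xs" "\<not> length xs - 1 - length xs div 2 < length xs div 2"
    using assms by (auto elim!: oddE)
  then show ?thesis
    by (simp add: sym_gram_schmidt_def Let_def sgs_mid_def
        others_mid_eq_outer[OF assms, unfolded others_def])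
qed

lemma pair_cases:
  fixes i q :: nat
  assumes "i < q"
  obtains (left) "i < q div 2"
    | (right) r where "r < q div 2" "i = q - 1 - r"
    | (mid) "odd q" "i = q div 2"
proof -
  have "i < q div 2 \<or> q - 1 - i < q div 2 \<or> odd q \<and> i = q div 2"
  proof (cases "even q")
    case True
    then obtain b where "q = 2 * b" by (elim evenE)
    then show ?thesis using assms by (simp, linarith)
  next
    case False
    then obtain b where "q = 2 * b + 1" by (elim oddE)
    then show ?thesis using assms by (simp, linarith)
  qed
  then show ?thesis
  proof (elim disjE)
    assume 2: "q - 1 - i < q div 2"
    have "i = q - 1 - (q - 1 - i)" using assms by simp
    with 2 show ?thesis by (rule right)
  qed (use left mid in auto)
qed

context gram_space
begin

lemma normalize_in_subspace: "lin_subspace d W \<Longrightarrow> v \<in> W \<Longrightarrow> normalize_vec A v \<in> W"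
  using lin_subspaceD(4) by (simp add: normalize_vec_def)

text \<open>Two unit vectors have orthogonal sum and difference, the diagonals of a rhombus. Normalized,
  these form an orthonormal pair, and \<open>y\<close>, \<open>z\<close> arise from it by an orthogonal 2 by 2 matrix.\<close>

lemma symmetrized_pair:
  fixes u v
  defines "a \<equiv> normalize_vec A (u + v)" and "b \<equiv> normalize_vec A (u - v)"
  defines "y \<equiv> (1 / sqrt 2) \<cdot>\<^sub>v (a + b)" and "z \<equiv> (1 / sqrt 2) \<cdot>\<^sub>v (a - b)"
  assumes c: "u \<in> carrier_vec d" "v \<in> carrier_vec d"
    and n: "ip A u u = 1" "ip A v v = 1" and nz: "u + v \<noteq> 0\<^sub>v d" "u - v \<noteq> 0\<^sub>v d"
  shows "ip A y y = 1" "ip A z z = 1" "ip A y z = 0"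
proof -
  have ab: "a \<in> carrier_vec d" "b \<in> carrier_vec d" using c by (auto simp: a_def b_def)
  have n1: "ip A a a = 1" "ip A b b = 1"
    using ip_normalize_self c nz by (auto simp: a_def b_def)
  have "ip A (u + v) (u - v) = 0"
    using c n ip_sym[of u v] by (simp add: ip_simps)
  then have o: "ip A a b = 0" "ip A b a = 0"
    using ip_sym[OF ab] c by (simp_all add: a_def b_def normalize_vec_def ip_smult_left ip_smult_right)
  show "ip A y y = 1" "ip A z z = 1" "ip A y z = 0"
    using ab n1 o by (simp_all add: y_def z_def ip_simps)
qed

text \<open>What is needed of the residuals of round \<open>r\<close>. The last fact is how linear independence enters:
  a residual inside the span of the other inputs would put \<open>xs ! i\<close> itself there.\<close>

lemma resid_outer:
  fixes xs r i
  defines "t \<equiv> resid A (outer xs r) (xs ! i)"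
  assumes xs: "set xs \<subseteq> carrier_vec d" and i: "i < length xs" and ri: "r \<le> min i (length xs - 1 - i)"
  shows "t \<in> carrier_vec d"
    and "v \<in> outer xs r \<Longrightarrow> ip A t v = 0"
    and "outer xs r \<subseteq> T \<Longrightarrow> xs ! i \<in> T \<Longrightarrow> T \<subseteq> carrier_vec d \<Longrightarrow> t \<in> vec_span d T"
    and "indep d xs \<Longrightarrow> t \<notin> vec_span d (others xs i)"
proof -
  have O: "outer xs r \<subseteq> carrier_vec d" and x: "xs ! i \<in> carrier_vec d"
    using outer_subset xs i by (auto simp: subset_iff)
  define w where "w = orth_proj A (vec_span d (outer xs r)) (xs ! i)"
  have t: "t = xs ! i - w" by (simp add: t_def w_def resid_def)
  note P = orth_proj[OF finite_outer O x, folded w_def]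
  have w: "w \<in> carrier_vec d" using P(1) vec_span_closed(1)[OF O] by auto
  show "t \<in> carrier_vec d" using x w by (simp add: t)
  show "v \<in> outer xs r \<Longrightarrow> ip A t v = 0"
    using P(2) vec_span_closed(2)[OF O] by (simp add: t)
  show "t \<in> vec_span d T" if T: "outer xs r \<subseteq> T" "xs ! i \<in> T" "T \<subseteq> carrier_vec d"
  proof -
    have "outer xs r \<subseteq> vec_span d T" using T vec_span_superset by blast
    then have "w \<in> vec_span d T" using P(1) vec_span_mono[OF T(3)] by auto
    then show ?thesis unfolding t using T
      by (auto intro!: vec_span_closed(5)[OF T(3)] intro: vec_span_closed(2))
  qed
  show "t \<notin> vec_span d (others xs i)" if "indep d xs"
  proof
    have T: "others xs i \<subseteq> carrier_vec d" using others_subset xs by blast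
    assume a: "t \<in> vec_span d (others xs i)"
    have "outer xs r \<subseteq> others xs i" using ri by (fastforce simp: outer_def others_def)
    then have "outer xs r \<subseteq> vec_span d (others xs i)" using vec_span_superset[OF T] by blast
    then have "w \<in> vec_span d (others xs i)" using P(1) vec_span_mono[OF T] by auto
    with a have "t + w \<in> vec_span d (others xs i)" by (rule vec_span_closed(4)[OF T])
    moreover have "t + w = xs ! i" unfolding t using x w by (rule vec_diff_add_cancel)
    ultimately show False using that i by (auto simp: indep_def)
  qed
qed

definition orthonormal :: "real vec list \<Rightarrow> bool" where
  "orthonormal xs \<longleftrightarrow> (\<forall>i<length xs. \<forall>j<length xs. ip A (xs ! i) (xs ! j) = (if i = j then 1 else 0))"

text \<open>Each output is a linear combination of the one or two residuals of its round. Applied to a span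
  this bounds the span of the outputs, applied to an orthogonal complement it gives orthogonality to the
  earlier rounds.\<close>

lemma sym_gram_schmidt_in_subspace:
  assumes W: "lin_subspace d W" and i: "i < length xs" and r: "r = min i (length xs - 1 - i)"
    and R: "\<And>j. j < length xs \<Longrightarrow> r = min j (length xs - 1 - j) \<Longrightarrow> resid A (outer xs r) (xs ! j) \<in> W"
  shows "sym_gram_schmidt A xs ! i \<in> W"
proof -
  note N = normalize_in_subspace[OF W]
  have pair: "sym_gram_schmidt A xs ! r \<in> W \<and> sym_gram_schmidt A xs ! (length xs - 1 - r) \<in> W"
    if "r < length xs div 2"
  proof -
    have "resid A (outer xs r) (xs ! r) \<in> W" "resid A (outer xs r) (xs ! (length xs - 1 - r)) \<in> W"
      using that by (auto intro!: R)
    then show ?thesis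
      unfolding sym_gram_schmidt_nth[OF that] by (intro conjI lin_subspaceD(3-5)[OF W] N)
  qed
  show ?thesis
    using i
  proof (cases rule: pair_cases)
    case left
    then have "r = i" using r by auto
    then show ?thesis using pair left by simp
  next
    case (right s)
    then have "r = s" using r by auto
    then show ?thesis using pair right by simp
  next
    case mid
    then have "r = i" using r by (auto elim!: oddE)
    then show ?thesis using mid R[OF i r] by (simp add: sym_gram_schmidt_nth_mid N)
  qed
qed

lemma sym_gram_schmidt_in_span:
  assumes xs: "set xs \<subseteq> carrier_vec d" and i: "i < length xs"
  shows "sym_gram_schmidt A xs ! i \<in> vec_span d (outer xs (Suc (min i (length xs - 1 - i))))"
proof (rule sym_gram_schmidt_in_subspace[OF _ i refl])
  let ?r = "min i (length xs - 1 - i)"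
  have O: "outer xs (Suc ?r) \<subseteq> carrier_vec d"
    using outer_subset xs by blast
  then show "lin_subspace d (vec_span d (outer xs (Suc ?r)))" by (rule lin_subspace_vec_span)
  fix j assume j: "j < length xs" "?r = min j (length xs - 1 - j)"
  then have "xs ! j \<in> outer xs (Suc ?r)" unfolding outer_def by auto
  then show "resid A (outer xs ?r) (xs ! j) \<in> vec_span d (outer xs (Suc ?r))"
    using j by (intro resid_outer(3)[OF xs] outer_mono O) simp_all
qed

lemma sym_gram_schmidt_span:
  assumes "set xs \<subseteq> carrier_vec d"
  shows "set (sym_gram_schmidt A xs) \<subseteq> vec_span d (set xs)"
proof -
  have "vec_span d (outer xs r) \<subseteq> vec_span d (set xs)" for r
    using assms outer_subset vec_span_superset by (intro vec_span_mono) blast+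
  then show ?thesis
    using sym_gram_schmidt_in_span[OF assms] by (fastforce simp: in_set_conv_nth)
qed

lemma sym_gram_schmidt_carrier:
  assumes "set xs \<subseteq> carrier_vec d"
  shows "set (sym_gram_schmidt A xs) \<subseteq> carrier_vec d"
  using sym_gram_schmidt_span[OF assms] vec_span_closed(1)[OF assms] by blast

lemma sym_gram_schmidt_orth_outer:
  assumes xs: "set xs \<subseteq> carrier_vec d" and i: "i < length xs"
    and v: "v \<in> outer xs (min i (length xs - 1 - i))"
  shows "ip A (sym_gram_schmidt A xs ! i) v = 0"
proof -
  let ?r = "min i (length xs - 1 - i)"
  have vc: "v \<in> carrier_vec d" using v outer_subset xs by blast
  have "sym_gram_schmidt A xs ! i \<in> {w \<in> carrier_vec d. ip A v w = 0}"
  proof (rule sym_gram_schmidt_in_subspace[OF lin_subspace_orth_complement[OF vc] i refl])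
    fix j assume j: "j < length xs" "?r = min j (length xs - 1 - j)"
    then have "?r \<le> min j (length xs - 1 - j)" by simp
    note R = resid_outer(1,2)[OF xs j(1) this]
    show "resid A (outer xs ?r) (xs ! j) \<in> {w \<in> carrier_vec d. ip A v w = 0}"
      using R(1) R(2)[OF v] ip_sym[OF vc R(1)] by (metis (mono_tags, lifting) mem_Collect_eq)
  qed
  then show ?thesis using ip_sym[OF vc] by auto
qed

lemma smult_eq_imp_in_subspace:
  assumes W: "lin_subspace d W" and t: "t \<in> carrier_vec d" and c: "c \<noteq> 0" and s: "c \<cdot>\<^sub>v t \<in> W"
  shows "t \<in> W"
proof -
  have "(1 / c) \<cdot>\<^sub>v (c \<cdot>\<^sub>v t) = t" using t c by (intro eq_vecI) auto
  then show ?thesis using lin_subspaceD(4)[OF W s, of "1 / c"] by simp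
qed

lemma normalize_in_subspaceD:
  assumes W: "lin_subspace d W" and t: "t \<in> carrier_vec d" and s: "normalize_vec A t \<in> W"
  shows "t \<in> W"
proof (cases "t = 0\<^sub>v d")
  case True
  then show ?thesis using lin_subspaceD(2)[OF W] by simp
next
  case False
  then have "ip_norm A t > 0" using ip_pos t by (simp add: ip_norm_def)
  then show ?thesis using smult_eq_imp_in_subspace[OF W t, of "1 / ip_norm A t"] s
    by (simp add: normalize_vec_def)
qed

text \<open>Only \<open>u + v \<noteq> 0\<close> and \<open>u - v \<noteq> 0\<close> have to be checked before \<open>symmetrized_pair\<close> applies. Both
  hold because \<open>v\<close> lies in the span \<open>W\<close> of all inputs except \<open>xs ! r\<close>, while \<open>u\<close> does not.\<close>

lemma sym_gram_schmidt_pair: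
  assumes xs: "set xs \<subseteq> carrier_vec d" and ind: "indep d xs" and r: "r < length xs div 2"
  shows "ip A (sym_gram_schmidt A xs ! r) (sym_gram_schmidt A xs ! r) = 1"
    and "ip A (sym_gram_schmidt A xs ! (length xs - 1 - r)) (sym_gram_schmidt A xs ! (length xs - 1 - r)) = 1"
    and "ip A (sym_gram_schmidt A xs ! r) (sym_gram_schmidt A xs ! (length xs - 1 - r)) = 0"
proof -
  let ?q = "length xs - 1 - r"
  define t s where "t = resid A (outer xs r) (xs ! r)" and "s = resid A (outer xs r) (xs ! ?q)"
  define u v where "u = normalize_vec A t" and "v = normalize_vec A s"
  define W where "W = vec_span d (others xs r)"
  have q: "?q < length xs" "r < length xs" "?q \<noteq> r" "r \<le> min r (length xs - 1 - r)"
    "r \<le> min ?q (length xs - 1 - ?q)" using r by auto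
  have oc: "others xs i \<subseteq> carrier_vec d" for i using others_subset xs by blast
  have W: "lin_subspace d W" unfolding W_def by (rule lin_subspace_vec_span[OF oc])
  have tc: "t \<in> carrier_vec d" "s \<in> carrier_vec d" "t \<notin> W" "s \<notin> vec_span d (others xs ?q)"
    unfolding t_def s_def W_def
    by (fact resid_outer(1,4)[OF xs q(2,4)] resid_outer(1,4)[OF xs q(1,5)]
        resid_outer(4)[OF xs q(2,4) ind] resid_outer(4)[OF xs q(1,5) ind])+
  have "outer xs r \<subseteq> others xs r"
    using r by (fastforce simp: outer_def others_def)
  moreover have "xs ! ?q \<in> others xs r" using q by (auto simp: others_def)
  ultimately have "s \<in> W"
    unfolding s_def W_def using q oc by (intro resid_outer(3) xs) auto
  then have vW: "v \<in> W" unfolding v_def by (rule normalize_in_subspace[OF W])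
  have uW: "u \<notin> W" using normalize_in_subspaceD[OF W tc(1)] tc(3) unfolding u_def by auto
  have c: "u \<in> carrier_vec d" "v \<in> carrier_vec d" using tc by (auto simp: u_def v_def)
  have "s \<noteq> 0\<^sub>v d" "t \<noteq> 0\<^sub>v d"
    using tc lin_subspaceD(2)[OF W] vec_span_closed(3)[OF oc] by auto
  then have n: "ip A u u = 1" "ip A v v = 1" using tc by (auto simp: u_def v_def ip_normalize_self)
  have p: "u + v \<noteq> 0\<^sub>v d"
  proof
    assume a: "u + v = 0\<^sub>v d"
    have "(-1) \<cdot>\<^sub>v v = 0\<^sub>v d - v" using c by (intro eq_vecI) auto
    also have "\<dots> = (u + v) - v" using a by simp
    also have "\<dots> = u" using c by (intro eq_vecI) auto
    finally show False using uW lin_subspaceD(4)[OF W vW, of "-1"] by simp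
  qed
  have m: "u - v \<noteq> 0\<^sub>v d"
  proof
    assume a: "u - v = 0\<^sub>v d"
    have "u = u - v + v" using vec_diff_add_cancel c by metis
    also have "\<dots> = v" using a c by simp
    finally show False using uW vW by simp
  qed
  show "ip A (sym_gram_schmidt A xs ! r) (sym_gram_schmidt A xs ! r) = 1"
    and "ip A (sym_gram_schmidt A xs ! ?q) (sym_gram_schmidt A xs ! ?q) = 1"
    and "ip A (sym_gram_schmidt A xs ! r) (sym_gram_schmidt A xs ! ?q) = 0"
    unfolding sym_gram_schmidt_nth[OF r] t_def[symmetric] s_def[symmetric] u_def[symmetric] v_def[symmetric]
    using symmetrized_pair[OF c n p m] by auto
qed

lemma sym_gram_schmidt_norm:
  assumes xs: "set xs \<subseteq> carrier_vec d" and ind: "indep d xs" and i: "i < length xs"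
  shows "ip A (sym_gram_schmidt A xs ! i) (sym_gram_schmidt A xs ! i) = 1"
  using i
proof (cases rule: pair_cases)
  case left
  then show ?thesis using sym_gram_schmidt_pair(1)[OF xs ind] by simp
next
  case (right r)
  then show ?thesis using sym_gram_schmidt_pair(2)[OF xs ind] by simp
next
  case mid
  have oc: "others xs i \<subseteq> carrier_vec d" using others_subset xs by blast
  have ri: "length xs div 2 \<le> min i (length xs - 1 - i)" using mid by (auto elim!: oddE)
  note R = resid_outer[OF xs i ri]
  have "resid A (outer xs (length xs div 2)) (xs ! i) \<noteq> 0\<^sub>v d"
    using R(4)[OF ind] vec_span_closed(3)[OF oc] by auto
  then show ?thesis using R(1) mid by (simp add: sym_gram_schmidt_nth_mid ip_normalize_self)
qed

text \<open>The output of the earlier round is in the span of inputs to which the later output is orthogonal.\<close>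

lemma sym_gram_schmidt_orthogonal_rounds:
  assumes xs: "set xs \<subseteq> carrier_vec d" and i: "i < length xs" and j: "j < length xs"
    and ij: "min i (length xs - 1 - i) < min j (length xs - 1 - j)"
  shows "ip A (sym_gram_schmidt A xs ! j) (sym_gram_schmidt A xs ! i) = 0"
proof -
  let ?y = "sym_gram_schmidt A xs"
  have O: "outer xs r \<subseteq> carrier_vec d" for r using outer_subset xs by blast
  have c: "?y ! j \<in> carrier_vec d" using sym_gram_schmidt_carrier[OF xs] j by auto
  have "orth {?y ! j} (outer xs (min j (length xs - 1 - j)))"
    using sym_gram_schmidt_orth_outer[OF xs j] by (auto simp: orth_def)
  then have "orth {?y ! j} (outer xs (Suc (min i (length xs - 1 - i))))"
    using outer_mono[of "Suc (min i (length xs - 1 - i))" "min j (length xs - 1 - j)" xs] ij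
    by (auto simp: orth_def)
  then have "orth {?y ! j} (vec_span d (outer xs (Suc (min i (length xs - 1 - i)))))"
    using c by (intro orth_span_right O) auto
  then show ?thesis using sym_gram_schmidt_in_span[OF xs i] by (auto simp: orth_def)
qed

lemma sym_gram_schmidt_orthonormal:
  assumes xs: "set xs \<subseteq> carrier_vec d" and ind: "indep d xs"
  shows "orthonormal (sym_gram_schmidt A xs)"
  unfolding orthonormal_def
proof (intro allI impI)
  let ?y = "sym_gram_schmidt A xs" and ?q = "length xs"
  fix i j assume "i < length ?y" "j < length ?y"
  then have i: "i < ?q" and j: "j < ?q" by auto
  have c: "?y ! i \<in> carrier_vec d" "?y ! j \<in> carrier_vec d"
    using sym_gram_schmidt_carrier[OF xs] i j by auto
  consider "i = j" | "min i (?q - 1 - i) < min j (?q - 1 - j)" | "min j (?q - 1 - j) < min i (?q - 1 - i)"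
    | "i < ?q div 2" "j = ?q - 1 - i" | "j < ?q div 2" "i = ?q - 1 - j"
    using i j by linarith
  then show "ip A (?y ! i) (?y ! j) = (if i = j then 1 else 0)"
  proof cases
    case 1
    then show ?thesis using sym_gram_schmidt_norm[OF xs ind i] by simp
  next
    case 2
    then show ?thesis using sym_gram_schmidt_orthogonal_rounds[OF xs i j] ip_sym[OF c] by auto
  next
    case 3
    then show ?thesis using sym_gram_schmidt_orthogonal_rounds[OF xs j i] by auto
  next
    case 4
    then show ?thesis using sym_gram_schmidt_pair(3)[OF xs ind 4(1)] by auto
  next
    case 5
    then show ?thesis using sym_gram_schmidt_pair(3)[OF xs ind 5(1)] ip_sym[OF c] by auto
  qed
qed

end

section \<open>Equivariance under sign changes\<close>

text \<open>The symmetrization makes the procedure equivariant under sign changes of single inputs: if \<open>x\<^sub>r\<close>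
  is replaced by \<open>-x\<^sub>r\<close>, then \<open>u + v\<close> and \<open>u - v\<close> are exchanged up to sign, hence \<open>y\<^sub>r\<close> changes its sign and
  its partner stays the same. Consequently an isometry that maps every input to plus or minus itself
  multiplies each output by the sign that belongs to the input in the same position.\<close>

context gram_space
begin

definition isometry :: "(real vec \<Rightarrow> real vec) \<Rightarrow> bool" where
  "isometry R \<longleftrightarrow> (\<forall>v\<in>carrier_vec d. R v \<in> carrier_vec d) \<and>
     (\<forall>u\<in>carrier_vec d. \<forall>v\<in>carrier_vec d. R (u + v) = R u + R v) \<and>
     (\<forall>c. \<forall>v\<in>carrier_vec d. R (c \<cdot>\<^sub>v v) = c \<cdot>\<^sub>v R v) \<and>
     (\<forall>u\<in>carrier_vec d. \<forall>v\<in>carrier_vec d. ip A (R u) (R v) = ip A u v)"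

definition signed :: "(real vec \<Rightarrow> real vec) \<Rightarrow> real \<Rightarrow> real vec \<Rightarrow> bool" where
  "signed R e v \<longleftrightarrow> v \<in> carrier_vec d \<and> R v = e \<cdot>\<^sub>v v \<and> (e = 1 \<or> e = -1)"

context
  fixes R assumes R: "isometry R"
begin

lemma isometryD:
  shows "v \<in> carrier_vec d \<Longrightarrow> R v \<in> carrier_vec d"
    and "u \<in> carrier_vec d \<Longrightarrow> v \<in> carrier_vec d \<Longrightarrow> R (u + v) = R u + R v"
    and "v \<in> carrier_vec d \<Longrightarrow> R (c \<cdot>\<^sub>v v) = c \<cdot>\<^sub>v R v"
    and "u \<in> carrier_vec d \<Longrightarrow> v \<in> carrier_vec d \<Longrightarrow> ip A (R u) (R v) = ip A u v"
    and "u \<in> carrier_vec d \<Longrightarrow> v \<in> carrier_vec d \<Longrightarrow> R (u - v) = R u - R v"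
  using R by (auto simp: isometry_def minus_as_add)

lemma isometry_zero: "R (0\<^sub>v d) = 0\<^sub>v d"
proof -
  have "0 \<cdot>\<^sub>v 0\<^sub>v d = (0\<^sub>v d :: real vec)" by (intro eq_vecI) auto
  then have "R (0\<^sub>v d) = R (0 \<cdot>\<^sub>v 0\<^sub>v d)" by simp
  also have "\<dots> = 0 \<cdot>\<^sub>v R (0\<^sub>v d)" by (rule isometryD(3)) simp
  also have "\<dots> = 0\<^sub>v d" using isometryD(1)[of "0\<^sub>v d"] by (intro eq_vecI) auto
  finally show ?thesis .
qed

lemma signed_smult: "signed R e v \<Longrightarrow> signed R e (c \<cdot>\<^sub>v v)"
  by (auto simp: signed_def isometryD smult_smult_assoc mult.commute)

lemma signed_normalize: "signed R e v \<Longrightarrow> signed R e (normalize_vec A v)"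
  by (simp add: normalize_vec_def signed_smult)

lemma signed_minus:
  assumes "signed R e u" "signed R e v"
  shows "signed R e (u - v)"
proof -
  have "e \<cdot>\<^sub>v u - e \<cdot>\<^sub>v v = e \<cdot>\<^sub>v (u - v)"
    using assms by (intro eq_vecI) (auto simp: signed_def algebra_simps)
  then show ?thesis using assms by (auto simp: signed_def isometryD)
qed

lemma isometry_span:
  assumes S: "S \<subseteq> carrier_vec d" and sgn: "\<And>s. s \<in> S \<Longrightarrow> \<exists>e. signed R e s" and v: "v \<in> vec_span d S"
  shows "R v \<in> vec_span d S"
proof -
  note sp = vec_span_closed[OF S]
  have "lin_subspace d {v \<in> carrier_vec d. R v \<in> vec_span d S}"
    using sp isometry_zero by (auto simp: lin_subspace_def isometryD)
  moreover have "S \<subseteq> {v \<in> carrier_vec d. R v \<in> vec_span d S}"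
  proof
    fix s assume s: "s \<in> S"
    then obtain e where "signed R e s" using sgn by auto
    then show "s \<in> {v \<in> carrier_vec d. R v \<in> vec_span d S}"
      using sp(2)[OF s] sp(6) by (auto simp: signed_def)
  qed
  ultimately show ?thesis using vec_span_least v by blast
qed

lemma smult_sign_cancel:
  assumes "signed R e v"
  shows "e \<cdot>\<^sub>v R v = v"
  using assms by (auto simp: signed_def smult_smult_assoc)

text \<open>If \<open>w\<close> is the projection of \<open>x\<close>, then so is \<open>e \<cdot> R w\<close>, because \<open>R\<close> preserves the span as well as
  orthogonality; the projection is unique.\<close>

lemma signed_orth_proj:
  assumes fin: "finite S" and S: "S \<subseteq> carrier_vec d"
    and sgn: "\<And>s. s \<in> S \<Longrightarrow> \<exists>e. signed R e s" and x: "signed R e x"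
  shows "signed R e (orth_proj A (vec_span d S) x)"
proof -
  define w where "w = orth_proj A (vec_span d S) x"
  have xc: "x \<in> carrier_vec d" and e: "e = 1 \<or> e = -1" using x by (auto simp: signed_def)
  note P = orth_proj[OF fin S xc, folded w_def]
  note sp = vec_span_closed[OF S]
  have w: "w \<in> carrier_vec d" using P sp by auto
  define w' where "w' = e \<cdot>\<^sub>v R w"
  have w': "w' \<in> vec_span d S"
    unfolding w'_def by (intro sp(6) isometry_span[OF S sgn] P)
  then have w'c: "w' \<in> carrier_vec d" using sp by auto
  have xw: "x - w' = e \<cdot>\<^sub>v R (x - w)"
  proof -
    have "x - w' = e \<cdot>\<^sub>v R x - e \<cdot>\<^sub>v R w"
      using smult_sign_cancel[OF x] by (simp add: w'_def)
    also have "\<dots> = e \<cdot>\<^sub>v (R x - R w)"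
      using isometryD(1)[OF xc] isometryD(1)[OF w]
      by (intro eq_vecI) (auto simp: algebra_simps)
    finally show ?thesis using xc w by (simp add: isometryD)
  qed
  have "vec_span d S \<subseteq> {v \<in> carrier_vec d. ip A (x - w') v = 0}"
  proof (intro vec_span_least lin_subspace_orth_complement subsetI)
    show "x - w' \<in> carrier_vec d" using xc w'c by simp
    fix s assume s: "s \<in> S"
    then obtain f where f: "signed R f s" using sgn by auto
    have sc: "s \<in> carrier_vec d" using s S by auto
    have "ip A (x - w') s = ip A (e \<cdot>\<^sub>v R (x - w)) (f \<cdot>\<^sub>v R s)"
      using smult_sign_cancel[OF f] xw by simp
    also have "\<dots> = e * (f * ip A (x - w) s)"
      using xc w sc by (simp add: ip_smult_left ip_smult_right isometryD(1,4) del: isometryD(2,3,5))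
    also have "\<dots> = 0" using P(2) sp(2)[OF s] by simp
    finally show "s \<in> {v \<in> carrier_vec d. ip A (x - w') v = 0}" using sc by simp
  qed
  then have "w = w'"
    unfolding w_def using lin_subspace_vec_span[OF S] xc w'
    by (intro orth_proj_equality) auto
  then have "e \<cdot>\<^sub>v w = e \<cdot>\<^sub>v (e \<cdot>\<^sub>v R w)" by (simp add: w'_def)
  also have "\<dots> = R w" using e by (auto simp: smult_smult_assoc)
  finally show ?thesis using w e by (simp add: signed_def w_def)
qed

lemma signed_resid:
  assumes "finite S" "S \<subseteq> carrier_vec d" "\<And>s. s \<in> S \<Longrightarrow> \<exists>e. signed R e s" "signed R e x"
  shows "signed R e (resid A S x)"
  unfolding resid_def dim_A using assms by (intro signed_minus signed_orth_proj)

lemma ip_norm_smult_sign: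
  assumes "v \<in> carrier_vec d" "e = 1 \<or> e = -1"
  shows "ip_norm A (e \<cdot>\<^sub>v v) = ip_norm A v"
  using assms by (auto simp: ip_norm_def ip_smult_left ip_smult_right)

text \<open>For equal signs both normalized diagonals are multiplied by \<open>e\<close>. For opposite signs they are
  exchanged up to the factor \<open>e\<close>; as \<open>R\<close> is an isometry they have the same length, so normalization
  respects the exchange.\<close>

lemma signed_symmetrized_pair:
  fixes u v
  defines "a \<equiv> normalize_vec A (u + v)" and "b \<equiv> normalize_vec A (u - v)"
  assumes u: "signed R e u" and v: "signed R f v"
  shows "signed R e (c \<cdot>\<^sub>v (a + b))" "signed R f (c \<cdot>\<^sub>v (a - b))"
proof -
  have uv: "u \<in> carrier_vec d" "v \<in> carrier_vec d" and e: "e = 1 \<or> e = -1" and f: "f = 1 \<or> f = -1"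
    using u v by (auto simp: signed_def)
  have ab: "a \<in> carrier_vec d" "b \<in> carrier_vec d" using uv by (auto simp: a_def b_def)
  have Ruv: "R (u + v) = e \<cdot>\<^sub>v u + f \<cdot>\<^sub>v v" "R (u - v) = e \<cdot>\<^sub>v u - f \<cdot>\<^sub>v v"
    using u v by (auto simp: signed_def isometryD)
  have "R (a + b) = e \<cdot>\<^sub>v (a + b) \<and> R (a - b) = f \<cdot>\<^sub>v (a - b)"
  proof (cases "f = e")
    case True
    have "R (u + v) = e \<cdot>\<^sub>v (u + v)" "R (u - v) = e \<cdot>\<^sub>v (u - v)"
      unfolding Ruv True using uv by (auto intro!: eq_vecI simp: algebra_simps)
    then have "signed R e (u + v)" "signed R e (u - v)"
      using uv e by (auto simp: signed_def)
    then have "signed R e a" "signed R e b"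
      unfolding a_def b_def by (auto intro: signed_normalize)
    then show ?thesis
      using ab True by (auto simp: signed_def isometryD intro!: eq_vecI simp: algebra_simps)
  next
    case False
    then have fe: "f = - e" using e f by auto
    have sw: "R (u + v) = e \<cdot>\<^sub>v (u - v)" "R (u - v) = e \<cdot>\<^sub>v (u + v)"
      unfolding Ruv fe using uv by (auto intro!: eq_vecI simp: algebra_simps)
    have n: "ip_norm A (u + v) = ip_norm A (u - v)"
    proof -
      have "ip_norm A (u + v) = ip_norm A (R (u + v))"
        using uv by (simp add: ip_norm_def isometryD(4))
      then show ?thesis using sw ip_norm_smult_sign[of "u - v"] uv e by simp
    qed
    have Ra: "R a = e \<cdot>\<^sub>v b" "R b = e \<cdot>\<^sub>v a"
      using uv by (auto simp: a_def b_def normalize_vec_def n isometryD(3) sw smult_smult_assoc mult.commute)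
    show ?thesis
      using ab by (auto simp: isometryD(2,5) Ra fe intro!: eq_vecI simp: algebra_simps)
  qed
  then have "signed R e (a + b)" "signed R f (a - b)"
    using ab e f by (auto simp: signed_def)
  then show "signed R e (c \<cdot>\<^sub>v (a + b))" "signed R f (c \<cdot>\<^sub>v (a - b))"
    by (auto intro: signed_smult)
qed

lemma signed_sym_gram_schmidt:
  assumes xs: "\<And>i. i < length xs \<Longrightarrow> signed R (e i) (xs ! i)" and i: "i < length xs"
  shows "signed R (e i) (sym_gram_schmidt A xs ! i)"
proof -
  have c: "set xs \<subseteq> carrier_vec d" using xs by (auto simp: in_set_conv_nth signed_def)
  have S: "\<exists>e. signed R e s" if "s \<in> set xs" for s using that xs by (auto simp: in_set_conv_nth)
  have O: "outer xs r \<subseteq> carrier_vec d" for r using outer_subset c by blast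
  have N: "signed R (e j) (normalize_vec A (resid A (outer xs r) (xs ! j)))" if "j < length xs" for j r
    using that outer_subset by (intro signed_normalize signed_resid finite_outer O xs S) blast+
  show ?thesis
    using i
  proof (cases rule: pair_cases)
    case left
    then show ?thesis
      unfolding sym_gram_schmidt_nth(1)[OF left]
      by (intro signed_symmetrized_pair(1)[OF N N[of "length xs - 1 - i"]]) auto
  next
    case (right r)
    then show ?thesis
      unfolding right(2) sym_gram_schmidt_nth(2)[OF right(1)]
      by (intro signed_symmetrized_pair(2)[OF N[of r] N]) auto
  next
    case mid
    then show ?thesis using N i by (simp add: sym_gram_schmidt_nth_mid)
  qed
qed

end

end

section \<open>Levels and neighbouring tuplets\<close>

lemma multiplicity_two_power_odd:
  fixes x :: nat
  assumes "odd x"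
  shows "multiplicity 2 (2 ^ l * x) = l"
proof (rule multiplicity_eqI)
  show "\<not> 2 ^ Suc l dvd 2 ^ l * x"
    unfolding power_Suc2 using assms by (subst nat_mult_dvd_cancel1) auto
qed simp

lemma level_eq:
  assumes "j = 2 ^ l * (2 * c + 1)"
  shows "level j = l"
  unfolding level_def
proof (rule the_equality)
  show "\<exists>i\<ge>1. j = 2 ^ l * (2 * i - 1)"
    using assms by (intro exI[of _ "c + 1"]) simp
next
  fix l' assume "\<exists>i\<ge>1. j = 2 ^ l' * (2 * i - 1)"
  then obtain i where i: "i \<ge> 1" "j = 2 ^ l' * (2 * i - 1)" by blast
  have "odd (2 * c + 1)" "odd (2 * i - 1)" using i(1) by simp_all
  then have "multiplicity 2 j = l" "multiplicity 2 j = l'"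
    using assms i(2) multiplicity_two_power_odd by metis+
  then show "l' = l" by simp
qed

lemma level_decomp:
  assumes "j > 0"
  obtains c where "j = 2 ^ level j * (2 * c + 1)"
proof -
  obtain x where x: "j = 2 ^ multiplicity 2 j * x" "\<not> 2 dvd x"
    using assms multiplicity_decompose'[of j "2 :: nat"] by auto
  then obtain c where c: "x = 2 * c + 1" by (elim oddE)
  then show ?thesis using that level_eq x by metis
qed

lemma le_level_iff:
  assumes "j > 0"
  shows "l \<le> level j \<longleftrightarrow> 2 ^ l dvd j"
proof -
  obtain c where c: "j = 2 ^ level j * (2 * c + 1)" using level_decomp[OF assms] .
  show ?thesis
  proof
    assume "l \<le> level j"
    then show "2 ^ l dvd j" by (subst c) (simp add: le_imp_power_dvd)
  next
    assume l: "2 ^ l dvd j"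
    show "l \<le> level j"
    proof (rule ccontr)
      assume "\<not> l \<le> level j"
      then have "2 ^ Suc (level j) dvd j" using l by (meson not_less_eq_eq power_le_dvd)
      then have "2 ^ level j * 2 dvd 2 ^ level j * (2 * c + 1)" using c by (metis power_Suc2)
      then have "2 dvd 2 * c + 1" by (subst (asm) nat_mult_dvd_cancel1) simp_all
      then show False by simp
    qed
  qed
qed

text \<open>The tuplets that are used to update tuplet \<open>j\<close> in step \<open>l\<close> exist and have been orthonormalized
  in the same step.\<close>

lemma less_level_neighbours:
  assumes j: "0 < j" "j < 2 ^ N" and l: "l < level j"
  shows "0 < j - 2 ^ l" "j - 2 ^ l < 2 ^ N" "level (j - 2 ^ l) = l"
    and "0 < j + 2 ^ l" "j + 2 ^ l < 2 ^ N" "level (j + 2 ^ l) = l" and "2 ^ l < j"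
proof -
  have "2 ^ Suc l dvd j" using l le_level_iff[OF j(1), of "Suc l"] by (simp only: Suc_le_eq)
  then obtain c where c: "j = 2 ^ Suc l * c" by (elim dvdE)
  with j have c0: "c > 0" by (cases c) auto
  then obtain b where b: "c = Suc b" by (cases c) auto
  have m: "j - 2 ^ l = 2 ^ l * (2 * b + 1)" "j + 2 ^ l = 2 ^ l * (2 * c + 1)"
    unfolding c b by (simp_all add: algebra_simps)
  show "level (j - 2 ^ l) = l" "level (j + 2 ^ l) = l"
    using level_eq m by blast+
  show "0 < j - 2 ^ l" "0 < j + 2 ^ l" unfolding m by simp_all
  then show "2 ^ l < j" by simp
  show "j - 2 ^ l < 2 ^ N" using j by simp
  \<comment> \<open>The right neighbour stays below \<open>2 ^ N\<close> because \<open>j\<close> and \<open>2 ^ N\<close> are both multiples of \<open>2 ^ Suc l\<close>.\<close>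
  have "Suc l \<le> N"
  proof (rule ccontr)
    assume "\<not> Suc l \<le> N"
    then have "(2::nat) ^ N \<le> 2 ^ Suc l" by (intro power_increasing) auto
    also have "\<dots> \<le> j" using c0 by (simp add: c)
    finally show False using j by simp
  qed
  then obtain e where "N = Suc l + e" using le_Suc_ex by blast
  then have N: "(2::nat) ^ N = 2 ^ Suc l * 2 ^ e" by (simp add: power_add)
  then have "c < 2 ^ e" using j(2) unfolding c by simp
  then have "2 * c + 1 < 2 * 2 ^ e" by simp
  then have "2 ^ l * (2 * c + 1) < 2 ^ l * (2 * 2 ^ e)" by (intro mult_strict_left_mono) auto
  then show "j + 2 ^ l < 2 ^ N" unfolding m N by simp
qed

text \<open>The pairs of tuplets whose orthogonality is established before step \<open>l\<close>: all pairs with a member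
  that has been orthonormalized, and those of the remaining pairs, at multiples of \<open>2 ^ l\<close>, that are
  not adjacent. For \<open>l = 0\<close> this is the block tridiagonal shape of a band matrix.\<close>

definition settled :: "nat \<Rightarrow> nat \<Rightarrow> nat \<Rightarrow> bool" where
  "settled l i j \<longleftrightarrow> i \<noteq> j \<and> (level i < l \<or> level j < l \<or> i + 2 * 2 ^ l \<le> j \<or> j + 2 * 2 ^ l \<le> i)"

lemma multiple_gap:
  fixes i j :: nat
  assumes "2 ^ l dvd i" "2 ^ l dvd j" "i < j"
  obtains c where "j = i + 2 ^ l * Suc c"
proof -
  obtain a where a: "i = 2 ^ l * a" using assms by (elim dvdE)
  obtain b where b: "j = 2 ^ l * b" using assms by (elim dvdE)
  have "a < b" using assms(3) by (simp add: a b)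
  then obtain c where "b = a + Suc c" using less_imp_Suc_add by fastforce
  then have "j = i + 2 ^ l * Suc c" unfolding a b by (simp only: distrib_left)
  then show ?thesis using that by blast
qed

lemma distinct_multiples_far:
  assumes "0 < i" "0 < j" "l \<le> level i" "l \<le> level j" "i < j" "j \<noteq> i + 2 ^ l"
  shows "i + 2 * 2 ^ l \<le> j"
proof -
  obtain c where c: "j = i + 2 ^ l * Suc c"
    using assms by (auto simp: le_level_iff elim: multiple_gap)
  then have "c \<noteq> 0" using assms(6) by auto
  then have "2 ^ l * 2 \<le> 2 ^ l * Suc c" by (intro mult_le_mono2) auto
  then show ?thesis unfolding c by simp
qed

text \<open>Among the multiples of \<open>2 ^ l\<close>, adjacency is the only obstruction.\<close>

lemma settled_nonadjacent:
  assumes "0 < i" "0 < j" "i \<noteq> j" "i \<noteq> j + 2 ^ l" "j \<noteq> i + 2 ^ l"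
  shows "settled l i j"
proof (cases "level i < l \<or> level j < l")
  case True
  then show ?thesis using assms by (auto simp: settled_def)
next
  case False
  then show ?thesis
    using distinct_multiples_far[of i j l] distinct_multiples_far[of j i l] assms
    by (cases i j rule: linorder_cases) (auto simp: settled_def)
qed

text \<open>Two different odd multiples of \<open>2 ^ l\<close> are never adjacent, so the tuplets treated in one step are
  mutually orthogonal already and may be orthonormalized independently.\<close>

lemma settled_same_level:
  assumes "0 < i" "0 < j" "i \<noteq> j" "level i \<le> l" "level j \<le> l"
  shows "settled l i j"
proof (cases "level i < l \<or> level j < l")
  case True
  then show ?thesis using assms by (auto simp: settled_def)
next
  case False
  then have l: "level i = l" "level j = l" using assms by auto
  have "b \<noteq> a + 2 ^ l" if a: "0 < a" "level a = l" and lb: "level b = l" for a b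
  proof
    assume b: "b = a + 2 ^ l"
    obtain c where "a = 2 ^ l * (2 * c + 1)"
      using level_decomp[OF a(1)] unfolding a(2) by blast
    then have "b = 2 ^ Suc l * (c + 1)" unfolding b by (simp add: algebra_simps)
    then have "2 ^ Suc l dvd b" by (rule dvdI)
    moreover have "0 < b" using b by simp
    ultimately have "Suc l \<le> level b" using le_level_iff by blast
    then show False using lb by simp
  qed
  then show ?thesis using assms l by (intro settled_nonadjacent) auto
qed

section \<open>The invariant of the dyadic algorithm\<close>

locale dyadic = gram_space +
  fixes k N :: nat
  assumes d_eq: "d = k * (2 ^ N - 1)"
    and band: "i < d \<Longrightarrow> j < d \<Longrightarrow> i + k < j \<Longrightarrow> A $$ (i, j) = 0"
begin

definition idx :: "nat \<Rightarrow> nat \<Rightarrow> nat" where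
  "idx j i = (j - 1) * k + i"

text \<open>The reason why the tuplets still to be treated remain linearly independent: a vector of such a
  tuplet differs from its initial unit vector only in coordinates that belong to tuplets already treated.\<close>

definition coordinate_independent :: "nat \<Rightarrow> (nat \<Rightarrow> real vec list) \<Rightarrow> bool" where
  "coordinate_independent l T \<longleftrightarrow>
     (\<forall>j\<in>{0<..<2 ^ N}. \<forall>j'\<in>{0<..<2 ^ N}. \<forall>i<k. \<forall>i'<k. l \<le> level j \<longrightarrow> l \<le> level j' \<longrightarrow>
        (T j ! i) $ idx j' i' = (if j = j' \<and> i = i' then 1 else 0))"

definition tuplets :: "(nat \<Rightarrow> real vec list) \<Rightarrow> bool" where
  "tuplets T \<longleftrightarrow> (\<forall>j\<in>{0<..<2 ^ N}. length (T j) = k \<and> set (T j) \<subseteq> carrier_vec d)"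

definition invariant :: "nat \<Rightarrow> (nat \<Rightarrow> real vec list) \<Rightarrow> bool" where
  "invariant l T \<longleftrightarrow> tuplets T \<and>
     (\<forall>j\<in>{0<..<2 ^ N}. level j < l \<longrightarrow> orthonormal (T j)) \<and>
     (\<forall>j\<in>{0<..<2 ^ N}. \<forall>j'\<in>{0<..<2 ^ N}. settled l j j' \<longrightarrow> orth (set (T j)) (set (T j'))) \<and>
     coordinate_independent l T"

lemma idx_less:
  assumes "j \<in> {0<..<2 ^ N}" "i < k"
  shows "idx j i < d"
proof -
  have "idx j i < (j - 1) * k + k" using assms by (simp add: idx_def)
  also have "\<dots> = k * j" using assms by (cases j) auto
  also have "\<dots> \<le> d" using assms unfolding d_eq by (intro mult_le_mono2) auto
  finally show ?thesis .
qed

lemma idx_eq_iff: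
  assumes "0 < j" "0 < j'" "i < k" "i' < k"
  shows "idx j i = idx j' i' \<longleftrightarrow> j = j' \<and> i = i'"
proof
  assume "idx j i = idx j' i'"
  then have "(j - 1) * k + i = (j' - 1) * k + i'" by (simp add: idx_def)
  then have "((j - 1) * k + i) div k = ((j' - 1) * k + i') div k"
    "((j - 1) * k + i) mod k = ((j' - 1) * k + i') mod k" by simp_all
  then show "j = j' \<and> i = i'" using assms by simp
qed simp

lemma dyadic_init_nth: "i < k \<Longrightarrow> dyadic_init d k j ! i = unit_vec d (idx j i)"
  by (simp add: dyadic_init_def idx_def)

lemma ip_unit_vec:
  assumes "i < d" "j < d"
  shows "ip A (unit_vec d i) (unit_vec d j) = A $$ (i, j)"
  using assms A_carrier by (simp add: ip_def)

lemma tuplets_init: "tuplets (dyadic_init d k)"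
  by (auto simp: tuplets_def dyadic_init_def)

lemma invariant_init: "invariant 0 (dyadic_init d k)"
proof -
  have 1: "orth (set (dyadic_init d k j)) (set (dyadic_init d k j'))"
    if j: "j \<in> {0<..<2 ^ N}" "j' \<in> {0<..<2 ^ N}" and jj: "j + 2 \<le> j'" for j j'
    unfolding orth_def
  proof (intro ballI)
    fix u v assume "u \<in> set (dyadic_init d k j)" "v \<in> set (dyadic_init d k j')"
    then obtain i i' where i: "i < k" "u = unit_vec d (idx j i)" "i' < k" "v = unit_vec d (idx j' i')"
      by (auto simp: dyadic_init_def idx_def)
    have "idx j i + k < (j - 1) * k + 2 * k" using i by (simp add: idx_def)
    also have "\<dots> = (j + 1) * k" using j by (cases j) (auto simp: algebra_simps)
    also have "\<dots> \<le> (j' - 1) * k" using jj by (intro mult_le_mono1) auto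
    also have "\<dots> \<le> idx j' i'" by (simp add: idx_def)
    finally show "ip A u v = 0"
      using i j idx_less band by (simp add: ip_unit_vec)
  qed
  have c: "set (dyadic_init d k j) \<subseteq> carrier_vec d" for j by (auto simp: dyadic_init_def)
  have 2: "orth (set (dyadic_init d k j)) (set (dyadic_init d k j'))"
    if "j \<in> {0<..<2 ^ N}" "j' \<in> {0<..<2 ^ N}" "settled 0 j j'" for j j'
    using that 1[of j j'] orth_sym[OF c c 1[of j' j]] by (auto simp: settled_def)
  have 3: "coordinate_independent 0 (dyadic_init d k)"
    by (auto simp: coordinate_independent_def dyadic_init_nth idx_less idx_eq_iff)
  show ?thesis using 2 3 tuplets_init by (simp add: invariant_def)
qed

lemma lin_subspace_zero_coordinate:
  assumes "c < d"
  shows "lin_subspace d {v \<in> carrier_vec d. v $ c = 0}"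
  using assms by (auto simp: lin_subspace_def)

lemma indep_tuplet:
  assumes T: "tuplets T" and C: "coordinate_independent l T"
    and j: "j \<in> {0<..<2 ^ N}" and l: "l \<le> level j"
  shows "indep d (T j)"
  unfolding indep_def
proof (intro allI impI)
  fix i assume "i < length (T j)"
  then have i: "i < k" using T j by (simp add: tuplets_def)
  have "others (T j) i \<subseteq> {v \<in> carrier_vec d. v $ idx j i = 0}"
  proof
    fix v assume "v \<in> others (T j) i"
    then obtain i' where i': "i' < length (T j)" "i' \<noteq> i" "v = T j ! i'"
      by (auto simp: others_def)
    then have "v \<in> carrier_vec d" "i' < k" using T j by (auto simp: tuplets_def subset_iff)
    then show "v \<in> {v \<in> carrier_vec d. v $ idx j i = 0}"
      using C i i' j l by (simp add: coordinate_independent_def)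
  qed
  then have "vec_span d (others (T j) i) \<subseteq> {v \<in> carrier_vec d. v $ idx j i = 0}"
    by (intro vec_span_least lin_subspace_zero_coordinate idx_less j i)
  moreover have "T j ! i $ idx j i = 1"
    using C i j l by (simp add: coordinate_independent_def)
  ultimately show "T j ! i \<notin> vec_span d (others (T j) i)" by auto
qed

text \<open>One step of the algorithm. Let \<open>S\<close> be the state after the orthonormalizations and \<open>U\<close> the one
  after the projections. A remaining tuplet \<open>j\<close> loses its components along its neighbours
  \<open>j - 2 ^ l\<close> and \<open>j + 2 ^ l\<close>; these are orthogonal to each other, so subtracting the two projections
  separately gives orthogonality to both (\<open>Uadj\<close>). To all other tuplets of level at most \<open>l\<close> the three
  tuplets involved are orthogonal (\<open>Umix\<close>). Two remaining tuplets at distance at least \<open>4 * 2 ^ l\<close> stay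
  orthogonal because their neighbourhoods do not come closer than \<open>2 * 2 ^ l\<close> (\<open>Ufar\<close>).\<close>

lemma invariant_step:
  assumes inv: "invariant l T"
  shows "invariant (Suc l) (dyadic_proj_step A l (dyadic_orth_step A l T))"
proof -
  define S where "S = dyadic_orth_step A l T"
  define U where "U = dyadic_proj_step A l S"
  let ?I = "{0<..<2 ^ N} :: nat set"
  have T: "tuplets T" and on: "\<And>j. j \<in> ?I \<Longrightarrow> level j < l \<Longrightarrow> orthonormal (T j)"
    and od: "\<And>i j. i \<in> ?I \<Longrightarrow> j \<in> ?I \<Longrightarrow> settled l i j \<Longrightarrow> orth (set (T i)) (set (T j))"
    and ci: "coordinate_independent l T"
    using inv by (auto simp: invariant_def)
  have Tc: "set (T j) \<subseteq> carrier_vec d" and Tl: "length (T j) = k" if "j \<in> ?I" for j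
    using T that by (auto simp: tuplets_def)
  have Sj: "S j = (if level j = l then sym_gram_schmidt A (T j) else T j)" for j
    by (simp add: S_def dyadic_orth_step_def)
  have Ssp: "set (S j) \<subseteq> vec_span d (set (T j))" if "j \<in> ?I" for j
    using sym_gram_schmidt_span[OF Tc[OF that]] vec_span_superset[OF Tc[OF that]] by (simp add: Sj)
  have Sc: "set (S j) \<subseteq> carrier_vec d" if "j \<in> ?I" for j
    using Ssp[OF that] vec_span_closed(1)[OF Tc[OF that]] by blast
  have Sl: "length (S j) = k" if "j \<in> ?I" for j
    using Tl[OF that] by (simp add: Sj)
  have Son: "orthonormal (S j)" if "j \<in> ?I" "level j \<le> l" for j
    using that on sym_gram_schmidt_orthonormal[OF Tc indep_tuplet[OF T ci]] by (auto simp: Sj)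
  have Sod: "orth (set (S i)) (set (S j))" if "i \<in> ?I" "j \<in> ?I" "settled l i j" for i j
    using orth_mono[OF orth_span[OF Tc Tc od]] Ssp that by blast
  have nb: "j - 2 ^ l \<in> ?I" "j + 2 ^ l \<in> ?I" "level (j - 2 ^ l) = l" "level (j + 2 ^ l) = l" "2 ^ l < j"
    if "j \<in> ?I" "l < level j" for j
    using less_level_neighbours[of j N l] that by auto
  define w where "w m p = orth_proj A (vec_span d (set (S m))) p" for m p
  have wsp: "w m p \<in> vec_span d (set (S m))"
    and wor: "v \<in> set (S m) \<Longrightarrow> ip A (p - w m p) v = 0"
    and wc: "w m p \<in> carrier_vec d"
    if "m \<in> ?I" "p \<in> carrier_vec d" for m p v
    using orth_proj[OF _ Sc that(2)] vec_span_closed(1,2)[OF Sc] that by (auto simp: w_def)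
  have Ulo: "U j = S j" if "level j \<le> l" for j
    using that by (simp add: U_def dyadic_proj_step_def)
  have Uhi: "U j = map (\<lambda>p. p - w (j - 2 ^ l) p - w (j + 2 ^ l) p) (T j)" if "l < level j" for j
    using that by (simp add: U_def dyadic_proj_step_def w_def Sj)
  have Usp: "set (U j) \<subseteq> vec_span d (set (S j) \<union> set (S (j - 2 ^ l)) \<union> set (S (j + 2 ^ l)))"
    (is "_ \<subseteq> vec_span d ?X") if j: "j \<in> ?I" and l: "l < level j" for j
  proof
    have X: "?X \<subseteq> carrier_vec d" using Sc j nb[OF j l] by blast
    fix v assume "v \<in> set (U j)"
    then obtain p where p: "p \<in> set (T j)" and v: "v = p - w (j - 2 ^ l) p - w (j + 2 ^ l) p"
      by (auto simp: Uhi[OF l])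
    have pc: "p \<in> carrier_vec d" using p Tc j by blast
    have "p \<in> ?X" using p l by (simp add: Sj)
    moreover have "w m p \<in> vec_span d ?X" if "m = j - 2 ^ l \<or> m = j + 2 ^ l" for m
    proof -
      have "set (S m) \<subseteq> vec_span d ?X" using that vec_span_superset[OF X] by blast
      then show ?thesis using wsp[OF _ pc, of m] that nb[OF j l] vec_span_mono[OF X] by blast
    qed
    ultimately show "v \<in> vec_span d ?X"
      unfolding v by (intro vec_span_closed(5)[OF X]) (auto intro: vec_span_closed(2)[OF X])
  qed
  have Uc: "set (U j) \<subseteq> carrier_vec d" if j: "j \<in> ?I" for j
  proof (cases "l < level j")
    case True
    then show ?thesis using Tc[OF j] wc nb[OF j True] by (auto simp: Uhi)
  qed (use Sc[OF j] Ulo in auto)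
  have Uadj: "orth (set (U j)) (set (S i))"
    if j: "j \<in> ?I" and l: "l < level j" and i: "i = j - 2 ^ l \<or> i = j + 2 ^ l" for i j
    unfolding orth_def
  proof (intro ballI)
    let ?i' = "if i = j - 2 ^ l then j + 2 ^ l else j - 2 ^ l"
    fix u v assume "u \<in> set (U j)" and v: "v \<in> set (S i)"
    then obtain p where p: "p \<in> set (T j)" and u: "u = p - w (j - 2 ^ l) p - w (j + 2 ^ l) p"
      by (auto simp: Uhi[OF l])
    note nbj = nb[OF j l]
    have "(0::nat) < 2 ^ l" by simp
    then have "j - 2 ^ l < j + 2 ^ l" by linarith
    then have iI: "i \<in> ?I" "?i' \<in> ?I" "i \<noteq> ?i'" "level i = l" "level ?i' = l"
      using i nbj by (auto split: if_splits)
    have pc: "p \<in> carrier_vec d" using p Tc j by blast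
    have vc: "v \<in> carrier_vec d" using v Sc iI by blast
    have "settled l ?i' i" using iI by (intro settled_same_level) auto
    then have "orth (vec_span d (set (S ?i'))) (vec_span d (set (S i)))"
      using iI by (intro orth_span Sc Sod)
    then have "ip A (w ?i' p) v = 0"
      using wsp[OF iI(2) pc] v vec_span_superset[OF Sc[OF iI(1)]] unfolding orth_def by blast
    moreover have "ip A (p - w i p) v = 0" using wor[OF iI(1) pc v] .
    moreover have "u = p - w i p - w ?i' p"
      using i pc wc[OF nbj(1) pc] wc[OF nbj(2) pc] unfolding u by (auto intro!: eq_vecI)
    ultimately show "ip A u v = 0"
      using pc vc wc[OF iI(1) pc] wc[OF iI(2) pc] by (simp add: ip_minus_left)
  qed
  have Umix: "orth (set (U j)) (set (U i))"
    if j: "j \<in> ?I" and l: "l < level j" and i: "i \<in> ?I" "level i \<le> l" for i j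
  proof (cases "i = j - 2 ^ l \<or> i = j + 2 ^ l")
    case True
    then show ?thesis using Uadj[OF j l] Ulo i by simp
  next
    case False
    note nbj = nb[OF j l]
    have "settled l j i"
      using j i l False nbj(5) by (intro settled_nonadjacent) auto
    moreover have "settled l (j - 2 ^ l) i" "settled l (j + 2 ^ l) i"
      using i nbj False by (auto intro!: settled_same_level)
    ultimately have "orth (set (S j)) (set (S i))" "orth (set (S (j - 2 ^ l))) (set (S i))"
      "orth (set (S (j + 2 ^ l))) (set (S i))"
      using j i nbj by (auto intro!: Sod)
    then have o: "orth (set (S j) \<union> set (S (j - 2 ^ l)) \<union> set (S (j + 2 ^ l))) (set (S i))"
      by (auto simp: orth_def)
    have X: "set (S j) \<union> set (S (j - 2 ^ l)) \<union> set (S (j + 2 ^ l)) \<subseteq> carrier_vec d"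
      using Sc j nbj by blast
    show ?thesis
      using orth_mono[OF orth_span[OF X Sc[OF i(1)] o] Usp[OF j l] vec_span_superset[OF Sc[OF i(1)]]]
        Ulo[OF i(2)] by simp
  qed
  have Ufar: "orth (set (U i)) (set (U j))"
    if i: "i \<in> ?I" "l < level i" and j: "j \<in> ?I" "l < level j" and ij: "i + 2 * 2 ^ Suc l \<le> j" for i j
  proof -
    note nbi = nb[OF i] and nbj = nb[OF j]
    let ?X = "\<lambda>j. set (S j) \<union> set (S (j - 2 ^ l)) \<union> set (S (j + 2 ^ l))"
    have X: "?X i \<subseteq> carrier_vec d" "?X j \<subseteq> carrier_vec d" using Sc i j nbi nbj by blast+
    have "settled l a b" if "a \<in> {i, i - 2 ^ l, i + 2 ^ l}" "b \<in> {j, j - 2 ^ l, j + 2 ^ l}" for a b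
    proof -
      have "a \<le> i + 2 ^ l" "j \<le> b + 2 ^ l" using that by auto
      then have le: "a + 2 * 2 ^ l \<le> b" using ij by simp
      moreover have "a < a + 2 * 2 ^ l" by simp
      ultimately have "a \<noteq> b" by linarith
      then show ?thesis using le unfolding settled_def by blast
    qed
    then have "orth (set (S a)) (set (S b))"
      if "a \<in> {i, i - 2 ^ l, i + 2 ^ l}" "b \<in> {j, j - 2 ^ l, j + 2 ^ l}" for a b
      using that i j nbi nbj by (intro Sod) auto
    then have "orth (?X i) (?X j)" unfolding orth_def by blast
    then show ?thesis using orth_mono[OF orth_span[OF X] Usp[OF i] Usp[OF j]] by simp
  qed
  have Uod: "orth (set (U i)) (set (U j))" if i: "i \<in> ?I" and j: "j \<in> ?I" and s: "settled (Suc l) i j" for i j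
  proof -
    consider "level i \<le> l" "level j \<le> l" | "l < level i" "level j \<le> l" | "level i \<le> l" "l < level j"
      | "l < level i" "l < level j" by linarith
    then show ?thesis
    proof cases
      case 1
      then have "settled l i j" using i j s by (intro settled_same_level) (auto simp: settled_def)
      then show ?thesis using 1 Ulo Sod[OF i j] by simp
    next
      case 2
      then show ?thesis using Umix i j by blast
    next
      case 3
      then show ?thesis using Umix[OF j _ i] orth_sym[OF Uc[OF j] Uc[OF i]] by blast
    next
      case 4
      then have "i + 2 * 2 ^ Suc l \<le> j \<or> j + 2 * 2 ^ Suc l \<le> i" using s by (auto simp: settled_def)
      then show ?thesis
        using Ufar[OF i 4(1) j 4(2)] Ufar[OF j 4(2) i 4(1)] orth_sym[OF Uc[OF j] Uc[OF i]] by blast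
    qed
  qed
  have Uci: "coordinate_independent (Suc l) U"
    unfolding coordinate_independent_def
  proof (intro ballI allI impI)
    fix j j' i i' assume j: "j \<in> ?I" and j': "j' \<in> ?I" and i: "i < k" "i' < k"
      and "Suc l \<le> level j" "Suc l \<le> level j'"
    then have l: "l < level j" "l < level j'" by auto
    note nbj = nb[OF j l(1)]
    let ?Z = "{v \<in> carrier_vec d. v $ idx j' i' = 0}"
    have Z: "lin_subspace d ?Z" by (intro lin_subspace_zero_coordinate idx_less j' i)
    have w0: "w m (T j ! i) $ idx j' i' = 0" and wcm: "w m (T j ! i) \<in> carrier_vec d"
      if m: "m \<in> ?I" "level m = l" for m
    proof -
      have "m \<noteq> j'" using m l by auto
      have "set (T m) \<subseteq> ?Z"
      proof
        fix v assume v: "v \<in> set (T m)"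
        then obtain a where "a < k" "v = T m ! a" using Tl[OF m(1)] by (auto simp: in_set_conv_nth)
        then show "v \<in> ?Z"
          using v Tc[OF m(1)] ci m j' i l \<open>m \<noteq> j'\<close> by (auto simp: coordinate_independent_def)
      qed
      then have "set (S m) \<subseteq> ?Z" using Ssp[OF m(1)] vec_span_least[OF Z] by blast
      then have "vec_span d (set (S m)) \<subseteq> ?Z" by (rule vec_span_least[OF Z])
      moreover have "T j ! i \<in> carrier_vec d" using Tc[OF j] Tl[OF j] i by auto
      ultimately show "w m (T j ! i) $ idx j' i' = 0" "w m (T j ! i) \<in> carrier_vec d"
        using wsp[OF m(1)] by auto
    qed
    have "U j ! i = T j ! i - w (j - 2 ^ l) (T j ! i) - w (j + 2 ^ l) (T j ! i)"
      using Tl[OF j] i by (simp add: Uhi[OF l(1)])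
    then have "U j ! i $ idx j' i' = T j ! i $ idx j' i'"
      using wcm[OF nbj(1,3)] wcm[OF nbj(2,4)] w0[OF nbj(1,3)] w0[OF nbj(2,4)] idx_less[OF j' i(2)]
      by simp
    also have "\<dots> = (if j = j' \<and> i = i' then 1 else 0)"
      using ci j j' i l by (simp add: coordinate_independent_def)
    finally show "U j ! i $ idx j' i' = (if j = j' \<and> i = i' then 1 else 0)" .
  qed
  have Ul: "length (U j) = k" if "j \<in> ?I" for j
    using Sl[OF that] Tl[OF that] by (cases "l < level j") (auto simp: Uhi Ulo)
  have Uon: "orthonormal (U j)" if "j \<in> ?I" "level j < Suc l" for j
    using Son[OF that(1)] that Ulo by simp
  show ?thesis
    unfolding S_def[symmetric] U_def[symmetric] invariant_def tuplets_def
    using Uc Ul Uon Uod Uci by blast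
qed

end

section \<open>The output of the dyadic algorithm\<close>

lemma concat_nth_block:
  assumes "\<And>xs. xs \<in> set xss \<Longrightarrow> length xs = k" "j < length xss" "i < k"
  shows "concat xss ! (j * k + i) = xss ! j ! i"
  using assms
proof (induction xss arbitrary: j)
  case (Cons xs xss)
  have l: "length xs = k" using Cons.prems by simp
  show ?case
  proof (cases j)
    case 0
    then show ?thesis using l Cons.prems by (simp add: nth_append)
  next
    case (Suc j')
    then have "concat (xs # xss) ! (j * k + i) = concat xss ! (j' * k + i)"
      using l by (simp add: nth_append)
    also have "\<dots> = xss ! j' ! i" using Cons.prems Suc by (intro Cons.IH) auto
    finally show ?thesis using Suc by simp
  qed
qed simp

context dyadic
begin

definition state :: "nat \<Rightarrow> nat \<Rightarrow> real vec list" where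
  "state l = fold (\<lambda>l T. dyadic_proj_step A l (dyadic_orth_step A l T)) [0..<l] (dyadic_init d k)"

lemma state_simps [simp]:
  "state 0 = dyadic_init d k"
  "state (Suc l) = dyadic_proj_step A l (dyadic_orth_step A l (state l))"
  by (simp_all add: state_def)

lemma dyadic_state_eq: "dyadic_state k N A = state N"
  by (simp add: dyadic_state_def state_def)

lemma invariant_state: "invariant l (state l)"
  by (induction l) (simp_all add: invariant_init invariant_step)

lemma tuplets_state: "tuplets (state l)"
  using invariant_state by (simp add: invariant_def)

lemma level_less:
  assumes "j \<in> {0<..<2 ^ N}"
  shows "level j < N"
proof -
  obtain c where c: "j = 2 ^ level j * (2 * c + 1)" using level_decomp assms by auto
  have "2 ^ level j * 1 \<le> 2 ^ level j * (2 * c + 1)" by (intro mult_le_mono2) simp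
  then have "(2::nat) ^ level j < 2 ^ N" using c assms by (metis greaterThanLessThan_iff le_less_trans mult_1_right)
  then show ?thesis by simp
qed

lemma state_orthonormal:
  assumes j: "j \<in> {0<..<2 ^ N}" "j' \<in> {0<..<2 ^ N}" and i: "i < k" "i' < k"
  shows "ip A (state N j ! i) (state N j' ! i') = (if j = j' \<and> i = i' then 1 else 0)"
proof -
  have inv: "invariant N (state N)" by (rule invariant_state)
  then have len: "length (state N j) = k" "length (state N j') = k"
    using j by (auto simp: invariant_def tuplets_def)
  show ?thesis
  proof (cases "j = j'")
    case True
    then show ?thesis
      using inv i len j level_less[OF j(1)] by (auto simp: invariant_def orthonormal_def)
  next
    case False
    then have "settled N j j'" using level_less[OF j(1)] by (simp add: settled_def)
    then have "orth (set (state N j)) (set (state N j'))" using inv j by (auto simp: invariant_def)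
    then show ?thesis using False i len by (auto simp: orth_def)
  qed
qed

definition signed_tuplets :: "(real vec \<Rightarrow> real vec) \<Rightarrow> (nat \<Rightarrow> nat \<Rightarrow> real) \<Rightarrow> (nat \<Rightarrow> real vec list) \<Rightarrow> bool" where
  "signed_tuplets R e T \<longleftrightarrow> (\<forall>j\<in>{0<..<2 ^ N}. \<forall>i<k. signed R (e j i) (T j ! i))"

lemma signed_tuplets_step:
  assumes R: "isometry R" and T: "tuplets T" and sg: "signed_tuplets R e T"
  shows "signed_tuplets R e (dyadic_proj_step A l (dyadic_orth_step A l T))"
proof -
  let ?I = "{0<..<2 ^ N} :: nat set"
  define S where "S = dyadic_orth_step A l T"
  have Sj: "S j = (if level j = l then sym_gram_schmidt A (T j) else T j)" for j
    by (simp add: S_def dyadic_orth_step_def)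
  have Sl: "length (S j) = k" "length (T j) = k" if "j \<in> ?I" for j
    using T that by (auto simp: Sj tuplets_def)
  have Ss: "signed R (e j i) (S j ! i)" if "j \<in> ?I" "i < k" for j i
    using sg that Sl[OF that(1)] signed_sym_gram_schmidt[OF R, of "T j" "e j" i]
    by (auto simp: Sj signed_tuplets_def)
  have Sset: "\<exists>e. signed R e s" if "s \<in> set (S j)" "j \<in> ?I" for s j
  proof -
    obtain i where "i < length (S j)" "s = S j ! i" using \<open>s \<in> set (S j)\<close> by (auto simp: in_set_conv_nth)
    then show ?thesis using Ss[OF that(2), of i] Sl(1)[OF that(2)] by auto
  qed
  have Sc: "set (S j) \<subseteq> carrier_vec d" if "j \<in> ?I" for j
    using Sset that by (auto simp: signed_def)
  have "signed R (e j i) (dyadic_proj_step A l S j ! i)" if j: "j \<in> ?I" and i: "i < k" for j i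
  proof (cases "l < level j")
    case True
    note nb = less_level_neighbours[of j N l]
    have "signed R (e j i) (S j ! i - orth_proj A (vec_span d (set (S (j - 2 ^ l)))) (S j ! i)
        - orth_proj A (vec_span d (set (S (j + 2 ^ l)))) (S j ! i))"
      using nb j True
      by (intro signed_minus[OF R] signed_orth_proj[OF R] Ss Sc Sset i) auto
    then show ?thesis using True Sl(1)[OF j] i by (simp add: dyadic_proj_step_def)
  next
    case False
    then show ?thesis using Ss[OF j i] by (simp add: dyadic_proj_step_def)
  qed
  then show ?thesis by (simp add: signed_tuplets_def S_def)
qed

lemma signed_tuplets_state:
  assumes "isometry R" "signed_tuplets R e (state 0)"
  shows "signed_tuplets R e (state l)"
proof (induction l)
  case (Suc l)
  then show ?case using signed_tuplets_step[OF assms(1) tuplets_state] by simp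
qed (use assms in simp)

text \<open>Let the unit vector at \<open>c\<close> be orthogonal to all others. Then the reflection in coordinate \<open>c\<close> is an
  isometry, and it maps every initial vector to itself except for the one at position \<open>c\<close>, whose sign changes.\<close>

definition reflect :: "nat \<Rightarrow> real vec \<Rightarrow> real vec" where
  "reflect c v = vec d (\<lambda>i. if i = c then - v $ i else v $ i)"

lemma isometry_reflect:
  assumes "\<And>j. j < d \<Longrightarrow> j \<noteq> c \<Longrightarrow> A $$ (c, j) = 0" "\<And>j. j < d \<Longrightarrow> j \<noteq> c \<Longrightarrow> A $$ (j, c) = 0"
  shows "isometry (reflect c)"
proof -
  have "ip A (reflect c u) (reflect c v) = ip A u v" if "u \<in> carrier_vec d" "v \<in> carrier_vec d" for u v
  proof -
    have r: "reflect c u \<in> carrier_vec d" "reflect c v \<in> carrier_vec d" by (simp_all add: reflect_def)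
    show ?thesis
      unfolding ip_sum[OF that] ip_sum[OF r]
      using assms by (intro sum.cong) (auto simp: reflect_def)
  qed
  then show ?thesis
    unfolding isometry_def by (auto simp: reflect_def intro!: eq_vecI)
qed

definition column :: "nat \<Rightarrow> real vec" where
  "column c = state N (c div k + 1) ! (c mod k)"

lemma column_index:
  assumes "c < d"
  shows "c div k + 1 \<in> {0<..<2 ^ N}" "c mod k < k" "idx (c div k + 1) (c mod k) = c"
proof -
  have k: "k > 0" using assms by (cases k) (auto simp: d_eq)
  have "c div k < 2 ^ N - 1" using assms by (simp add: d_eq less_mult_imp_div_less mult.commute)
  then show "c div k + 1 \<in> {0<..<2 ^ N}" by auto
  show "c mod k < k" using k by simp
  show "idx (c div k + 1) (c mod k) = c" by (simp add: idx_def)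
qed

lemma column_carrier: "c < d \<Longrightarrow> column c \<in> carrier_vec d"
  using column_index tuplets_state[of N] nth_mem unfolding column_def tuplets_def by (metis subsetD)

lemma column_orthonormal:
  assumes "a < d" "b < d"
  shows "ip A (column a) (column b) = (if a = b then 1 else 0)"
  using state_orthonormal[OF column_index(1)[OF assms(1)] column_index(1)[OF assms(2)]
      column_index(2)[OF assms(1)] column_index(2)[OF assms(2)]]
    column_index(3)[OF assms(1)] column_index(3)[OF assms(2)]
  unfolding column_def by (metis (full_types))

lemma dyadic_orthogonalization_index:
  assumes r: "r < d" and c: "c < d"
  shows "dyadic_orthogonalization k N A $$ (r, c) = column c $ r"
proof -
  let ?L = "map (state N) [1..<2 ^ N]"
  have len: "\<And>xs. xs \<in> set ?L \<Longrightarrow> length xs = k"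
    using tuplets_state[of N] by (auto simp: tuplets_def)
  have j: "c div k < length ?L" using column_index(1)[OF c] by auto
  have n: "length (concat ?L) = d"
  proof -
    have "length (concat ?L) = sum_list (map (\<lambda>_. k) [1..<2 ^ N])"
      unfolding length_concat map_map using tuplets_state[of N]
      by (intro arg_cong[of _ _ sum_list] map_cong) (auto simp: tuplets_def)
    then show ?thesis by (simp add: sum_list_triv d_eq mult.commute)
  qed
  have "concat ?L ! c = concat ?L ! (c div k * k + c mod k)" by simp
  also have "\<dots> = ?L ! (c div k) ! (c mod k)"
    using len j column_index(2)[OF c] by (rule concat_nth_block)
  also have "\<dots> = column c" using j by (simp add: column_def)
  finally have "concat ?L ! c = column c" .
  then show ?thesis
    using r c n by (simp add: dyadic_orthogonalization_def dyadic_state_eq mat_of_cols_def)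
qed

text \<open>The reflection in coordinate \<open>c\<close> fixes the input at position \<open>a\<close>, hence by equivariance also the
  output there, and a vector fixed by this reflection has no component along \<open>c\<close>.\<close>

lemma column_zero_at_decoupled:
  assumes c: "c < d" and row: "\<And>j. j < d \<Longrightarrow> j \<noteq> c \<Longrightarrow> A $$ (c, j) = 0"
    and a: "a < d" "a \<noteq> c"
  shows "column a $ c = 0"
proof -
  have "transpose_mat A = A" using A_spd by (simp add: sym_pos_def_def)
  then have "A $$ (j, c) = A $$ (c, j)" if "j < d" for j
    using that c by (metis dim_A index_transpose_mat(1))
  then have R: "isometry (reflect c)" using row by (intro isometry_reflect) auto
  define e :: "nat \<Rightarrow> nat \<Rightarrow> real" where "e j i = (if idx j i = c then -1 else 1)" for j i
  have "signed_tuplets (reflect c) e (state 0)"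
    unfolding signed_tuplets_def signed_def
    by (auto simp: dyadic_init_nth e_def reflect_def idx_less intro!: eq_vecI)
  then have "signed_tuplets (reflect c) e (state N)" using R by (rule signed_tuplets_state[rotated])
  then have "signed (reflect c) 1 (column a)"
    using column_index[OF a(1)] a(2) unfolding column_def signed_tuplets_def e_def by fastforce
  then have "reflect c (column a) = column a" by (simp add: signed_def)
  moreover have "reflect c (column a) $ c = - column a $ c" using c by (simp add: reflect_def)
  ultimately show ?thesis by simp
qed

end

section \<open>Padding by an identity matrix\<close>

definition middle :: "nat \<Rightarrow> nat \<Rightarrow> real vec \<Rightarrow> real vec" where
  "middle u m v = vec m (\<lambda>i. v $ (i + u))"

definition pad_identity :: "nat \<Rightarrow> nat \<Rightarrow> nat \<Rightarrow> real mat \<Rightarrow> real mat" where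
  "pad_identity d u m H = mat d d (\<lambda>(i, j).
     if i \<in> {u..<u + m} \<and> j \<in> {u..<u + m} then H $$ (i - u, j - u) else if i = j then 1 else 0)"

text \<open>The padded form is an orthogonal sum. Both positive definiteness of the padded matrix and the
  passage from the columns of the large output matrix to those of its central part follow from this formula.\<close>

lemma ip_pad_identity:
  assumes um: "u + m \<le> d" and H: "H \<in> carrier_mat m m"
    and x: "x \<in> carrier_vec d" and y: "y \<in> carrier_vec d"
  shows "ip (pad_identity d u m H) x y =
    (\<Sum>i\<in>{..<d} - {u..<u + m}. x $ i * y $ i) + ip H (middle u m x) (middle u m y)"
proof -
  let ?A = "pad_identity d u m H" and ?C = "{u..<u + m}"
  have C: "?C \<subseteq> {..<d}" using um by auto
  have shift: "sum g ?C = (\<Sum>i<m. g (i + u))" for g :: "nat \<Rightarrow> real"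
    using sum.shift_bounds_nat_ivl[of g 0 u m] by (simp add: atLeast0LessThan add.commute)
  have "ip ?A x y = (\<Sum>i<d. \<Sum>j<d. x $ i * (?A $$ (i, j) * y $ j))"
    using x y by (auto simp: ip_def scalar_prod_def sum_distrib_left atLeast0LessThan pad_identity_def
        intro!: sum.cong)
  also have "\<dots> = (\<Sum>i\<in>{..<d} - ?C. \<Sum>j<d. x $ i * (?A $$ (i, j) * y $ j))
      + (\<Sum>i\<in>?C. \<Sum>j<d. x $ i * (?A $$ (i, j) * y $ j))"
    using C by (intro sum.subset_diff) auto
  also have "(\<Sum>i\<in>{..<d} - ?C. \<Sum>j<d. x $ i * (?A $$ (i, j) * y $ j))
      = (\<Sum>i\<in>{..<d} - ?C. x $ i * y $ i)"
  proof (rule sum.cong[OF refl])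
    fix i assume i: "i \<in> {..<d} - ?C"
    have "(\<Sum>j<d. x $ i * (?A $$ (i, j) * y $ j)) = (\<Sum>j<d. if j = i then x $ i * y $ i else 0)"
      using i by (intro sum.cong) (auto simp: pad_identity_def)
    then show "(\<Sum>j<d. x $ i * (?A $$ (i, j) * y $ j)) = x $ i * y $ i" using i by simp
  qed
  also have "(\<Sum>i\<in>?C. \<Sum>j<d. x $ i * (?A $$ (i, j) * y $ j))
      = (\<Sum>i\<in>?C. \<Sum>j\<in>?C. x $ i * (H $$ (i - u, j - u) * y $ j))"
  proof (rule sum.cong[OF refl])
    fix i assume i: "i \<in> ?C"
    have "(\<Sum>j<d. x $ i * (?A $$ (i, j) * y $ j)) = (\<Sum>j\<in>?C. x $ i * (?A $$ (i, j) * y $ j))"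
      using C i um by (intro sum.mono_neutral_right) (auto simp: pad_identity_def)
    also have "\<dots> = (\<Sum>j\<in>?C. x $ i * (H $$ (i - u, j - u) * y $ j))"
      using i um by (intro sum.cong) (auto simp: pad_identity_def)
    finally show "(\<Sum>j<d. x $ i * (?A $$ (i, j) * y $ j))
      = (\<Sum>j\<in>?C. x $ i * (H $$ (i - u, j - u) * y $ j))" .
  qed
  also have "\<dots> = (\<Sum>i<m. \<Sum>j<m. x $ (i + u) * (H $$ (i, j) * y $ (j + u)))"
    by (simp add: shift)
  also have "\<dots> = ip H (middle u m x) (middle u m y)"
    using H by (auto simp: ip_def scalar_prod_def sum_distrib_left atLeast0LessThan middle_def
        intro!: sum.cong)
  finally show ?thesis .
qed

lemma sym_pos_def_pad_identity:
  assumes um: "u + m \<le> d" and H: "H \<in> carrier_mat m m" and spd: "sym_pos_def H"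
  shows "sym_pos_def (pad_identity d u m H)"
  unfolding sym_pos_def_def
proof (intro conjI ballI impI)
  have sym: "H $$ (i, j) = H $$ (j, i)" if "i < m" "j < m" for i j
    using spd H that unfolding sym_pos_def_def by (metis carrier_matD index_transpose_mat(1))
  show "transpose_mat (pad_identity d u m H) = pad_identity d u m H"
    by (rule eq_matI) (auto simp: pad_identity_def intro!: sym)
  fix v :: "real vec"
  assume "v \<in> carrier_vec (dim_row (pad_identity d u m H))"
    and nz: "v \<noteq> 0\<^sub>v (dim_row (pad_identity d u m H))"
  then have v: "v \<in> carrier_vec d" "v \<noteq> 0\<^sub>v d" by (auto simp: pad_identity_def)
  let ?P = "{..<d} - {u..<u + m}"
  have mid: "middle u m v \<in> carrier_vec m" by (simp add: middle_def)
  have eq: "v \<bullet> (pad_identity d u m H *\<^sub>v v) = (\<Sum>i\<in>?P. v $ i * v $ i) + ip H (middle u m v) (middle u m v)"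
    using ip_pad_identity[OF um H v(1) v(1)] by (simp add: ip_def)
  have P: "(\<Sum>i\<in>?P. v $ i * v $ i) \<ge> 0" by (intro sum_nonneg) auto
  show "v \<bullet> (pad_identity d u m H *\<^sub>v v) > 0"
  proof (cases "middle u m v = 0\<^sub>v m")
    case False
    then have "ip H (middle u m v) (middle u m v) > 0"
      using spd H mid by (auto simp: ip_def sym_pos_def_def)
    then show ?thesis using eq P by simp
  next
    case True
    obtain i where i: "i < d" "v $ i \<noteq> 0" using v by (metis carrier_vecD eq_vecI index_zero_vec)
    have "i \<in> ?P"
    proof (rule ccontr)
      assume "i \<notin> ?P"
      then have "middle u m v $ (i - u) = v $ i" "i - u < m" using i by (auto simp: middle_def)
      then show False using True i by simp
    qed
    then have "(\<Sum>i\<in>?P. v $ i * v $ i) > 0" using i by (intro sum_pos2[of _ i]) (auto simp: zero_less_mult_iff neq_iff)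
    moreover have "ip H (middle u m v) (middle u m v) = 0" using True H by (simp add: ip_def)
    ultimately show ?thesis using eq by simp
  qed
qed

lemma transpose_mult_mult_index:
  assumes "H \<in> carrier_mat m m" "P \<in> carrier_mat m m" "a < m" "b < m"
  shows "(transpose_mat P * H * P) $$ (a, b) = ip H (col P a) (col P b)"
proof -
  have "transpose_mat P * H * P = transpose_mat P * (H * P)"
    using assms by (intro assoc_mult_mat[of _ m m _ m _ m]) auto
  then show ?thesis using assms by (simp add: ip_def col_mult2[of H m m P m] mult_mat_vec_def)
qed

text \<open>The number of levels is large enough for the padding to have nonnegative size, so that the natural
  number subtractions in the sizes of the two identity blocks are not truncated.\<close>

lemma le_mult_two_power_ceiling_log:
  assumes "k \<ge> (1::nat)" and "x \<ge> (1::nat)"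
  shows "x \<le> k * 2 ^ nat \<lceil>log 2 (real x / real k)\<rceil>"
proof -
  let ?y = "real x / real k"
  have y: "?y > 0" using assms by simp
  have "?y = 2 powr log 2 ?y" using y by simp
  also have "\<dots> \<le> 2 powr real (nat \<lceil>log 2 ?y\<rceil>)"
    by (intro powr_mono real_nat_ceiling_ge) simp
  also have "\<dots> = real (2 ^ nat \<lceil>log 2 ?y\<rceil>)" by (simp add: powr_realpow)
  finally have "real x \<le> real k * real (2 ^ nat \<lceil>log 2 ?y\<rceil>)"
    using assms by (simp add: field_simps)
  then show ?thesis by (metis of_nat_le_iff of_nat_mult)
qed

text \<open>The central columns of the output are orthonormal for the padded form and vanish on the padding, so
  their central parts are orthonormal for \<open>H\<close>.\<close>

lemma dyadic_orthogonalization_padded: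
  assumes d: "d = k * (2 ^ N - 1)" and um: "u + m \<le> d"
    and H: "H \<in> carrier_mat m m" "sym_pos_def H"
    and band: "\<And>i j. i < m \<Longrightarrow> j < m \<Longrightarrow> i + k < j \<Longrightarrow> H $$ (i, j) = 0"
    and P: "P = mat m m (\<lambda>(i, j). dyadic_orthogonalization k N (pad_identity d u m H) $$ (i + u, j + u))"
  shows "transpose_mat P * H * P = 1\<^sub>m m"
proof -
  let ?A = "pad_identity d u m H"
  interpret dyadic ?A d k N
  proof
    show "?A \<in> carrier_mat d d" by (simp add: pad_identity_def)
    show "sym_pos_def ?A" using um H by (rule sym_pos_def_pad_identity)
    show "d = k * (2 ^ N - 1)" by (rule d)
    fix i j assume "i < d" "j < d" "i + k < j"
    then show "?A $$ (i, j) = 0" by (auto simp: pad_identity_def intro!: band)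
  qed
  have zero: "column (a + u) $ i = 0" if a: "a < m" and i: "i \<in> {..<d} - {u..<u + m}" for a i
    using a i um by (intro column_zero_at_decoupled) (auto simp: pad_identity_def)
  have Pc: "P \<in> carrier_mat m m" by (simp add: P)
  have colP: "col P a = middle u m (column (a + u))" if "a < m" for a
    using that um by (intro eq_vecI) (auto simp: P middle_def dyadic_orthogonalization_index)
  have "(transpose_mat P * H * P) $$ (a, b) = (if a = b then 1 else 0)" if ab: "a < m" "b < m" for a b
  proof -
    have abd: "a + u < d" "b + u < d" using ab um by auto
    have "ip ?A (column (a + u)) (column (b + u))
        = ip H (middle u m (column (a + u))) (middle u m (column (b + u)))"
      using zero[OF ab(1)] abd
      by (simp add: ip_pad_identity[OF um H(1) column_carrier column_carrier])
    then show ?thesis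
      using column_orthonormal[OF abd] transpose_mult_mult_index[OF H(1) Pc ab] ab colP by simp
  qed
  then show ?thesis using Pc H by (intro eq_matI) auto
qed

theorem proposition5:
  fixes k n N m d n_U n_D :: nat and H H' P' P :: "real mat"
  assumes "k \<ge> 1" and "n \<ge> k"
    and "N = nat \<lceil>log 2 (real (n + 1) / real k)\<rceil>"
    and "m = n + 1 - k"
    and "d = k * (2 ^ N - 1)"
    and "n_U = (k * 2 ^ N - n - 1) div 2"
    and "n_D = k * 2 ^ N - n - 1 - n_U"
    and "H \<in> carrier_mat m m"
    and "sym_pos_def H"
    and "\<forall>i<m. \<forall>j<m. \<bar>int i - int j\<bar> > int k \<longrightarrow> H $$ (i, j) = 0"
    and "H' = mat d d (\<lambda>(i, j).
           if i = j \<and> (i < n_U \<or> i \<ge> d - n_D) then 1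
           else if i \<in> {n_U..<n_U + m} \<and> j \<in> {n_U..<n_U + m} then H $$ (i - n_U, j - n_U)
           else 0)"
    and "P' = dyadic_orthogonalization k N H'"
    and "P = mat m m (\<lambda>(i, j). P' $$ (i + n_U, j + n_U))"
  shows "1\<^sub>m m = transpose_mat P * H * P"
proof -
  have "n + 1 \<le> k * 2 ^ N"
    using le_mult_two_power_ceiling_log[OF assms(1), of "n + 1"] assms(3) by simp
  then have d: "d = n_U + m + n_D"
    using assms(2,4,7,6) by (simp add: assms(5) diff_mult_distrib2)
  then have "H' = pad_identity d n_U m H"
    unfolding assms(11) pad_identity_def by (intro cong_mat) auto
  then have "transpose_mat P * H * P = 1\<^sub>m m"
    using assms(5,8-10,12,13) d by (intro dyadic_orthogonalization_padded[of d k N n_U m]) auto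
  then show ?thesis by simp
qed

end
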